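(* There exists a connected semi-balanced directed graph $G$ such that for any ribbon structure and any basis of $G$, the dissection of the root polytope $\mathcal{Q}_G$ given by the simplices $\mathcal{Q}_T$ of the Jaeger trees $T$ is not a triangulation.
   Context: A directed graph is an orientation of a finite graph without loops and multiple edges; $\overrightarrow{th}$ denotes an edge with tail $t$ and head $h$, and $xy$ an edge whose orientation is not specified. Connectedness, cycles and spanning trees are meant in the underlying undirected graph. A directed graph is semi-balanced if each of its cycles has the same number of edges going in the two directions around the cycle. For $G=(V,E)$ let $\mathbf{v}\in\mathbf{R}^V$ be the standard basis vector of $v\in V$. The root polytope is $\mathcal{Q}_G=\mathrm{Conv}\{\mathbf{h}-\mathbf{t}\mid \overrightarrow{th}\in E\}$; for a spanning tree $T$, $\mathcal{Q}_T=\mathrm{Conv}\{\mathbf{h}-\mathbf{t}\mid \overrightarrow{th}\in T\}$ (a simplex). A ribbon structure on $G$ is a choice, for each vertex $x$, of a cyclic permutation of the edges incident to $x$; $xy^+$ denotes the edge following $xy$ at $x$. A basis is a pair $(b_0,b_0b_1)$ where $b_0$ is a vertex and $b_0b_1$ is an edge incident to $b_0$. The tour of a spanning tree $T$ is the sequence of node-edge pairs starting with $(b_0,b_0b_1)$ such that if the current pair is $(x,xy)$ and $xy\notin T$ then the next pair is $(x,xy^+)$, while if $xy\in T$ then the next pair is $(y,yx^+)$; it stops right before $(b_0,b_0b_1)$ would become current again. A spanning tree $T$ is a Jaeger tree if for each edge $\overrightarrow{th}\notin T$ the pair $(t,th)$ precedes $(h,th)$ in the tour of $T$. For a connected semi-balanced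 graph with any ribbon structure and basis, the simplices $\mathcal{Q}_T$ of Jaeger trees form a dissection of $\mathcal{Q}_G$ (mutually interior-disjoint maximal dimensional simplices with union $\mathcal{Q}_G$). A dissection is a triangulation if any two of its simplices intersect in a (possibly empty) common face. *)

theory Defs
  imports
    "HOL-Analysis.Analysis"
    "HOL-Analysis.Finite_Function_Topology"
    "HOL-Combinatorics.Orbits"
    "Graph_Theory.Digraph_Component"
begin

text \<open>
  A directed graph is a pair digraph; an arc \<open>(t, h)\<close> has tail \<open>t\<close> and head \<open>h\<close>.
  Asymmetry of the arc relation says that the underlying undirected graph has no multiple edges.
\<close>

definition oriented_graph :: "'a pair_pre_digraph \<Rightarrow> bool" where
  "oriented_graph G \<longleftrightarrow> pair_digraph G \<and> asym (parcs G)"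

text \<open>
  A cycle of the underlying undirected graph is a closed walk of the symmetrized digraph
  without repeated vertices; the bound on the length removes the walks \<open>x, y, x\<close> that go back and
  forth along a single edge. (For the same reason \<open>forest\<close> and \<open>spanning_tree\<close> of the AFP
  theory \<open>Digraph_Component\<close> are not used: they refer to directed cycles, which include these walks
  in a symmetric digraph and miss most cycles in an oriented one.)
\<close>

definition underlying_cycle :: "'a pair_pre_digraph \<Rightarrow> ('a \<times> 'a) list \<Rightarrow> bool" where
  "underlying_cycle G p \<longleftrightarrow>
     pre_digraph.cycle (with_proj (mk_symmetric (with_proj G))) p \<and> 3 \<le> length p"

definition semi_balanced :: "'a pair_pre_digraph \<Rightarrow> bool" where
  "semi_balanced G \<longleftrightarrow>
     (\<forall>p. underlying_cycle G p \<longrightarrow>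
        length (filter (\<lambda>(x, y). (x, y) \<in> parcs G) p) =
        length (filter (\<lambda>(x, y). (y, x) \<in> parcs G) p))"

definition spanning_tree_arcs :: "'a pair_pre_digraph \<Rightarrow> ('a \<times> 'a) set \<Rightarrow> bool" where
  "spanning_tree_arcs G T \<longleftrightarrow>
     T \<subseteq> parcs G \<and>
     Digraph_Component.connected (with_proj \<lparr>pverts = pverts G, parcs = T\<rparr>) \<and>
     (\<nexists>p. underlying_cycle \<lparr>pverts = pverts G, parcs = T\<rparr> p)"

text \<open>
  The space \<open>\<real>\<^sup>V\<close> is taken inside the finitely supported functions on the type of all vertices, which
  form a real vector space for every vertex type; the vector of \<open>v\<close> is \<open>Poly_Mapping.single v 1\<close>.
  For \<open>A\<close> the set of all arcs of a graph the following is its root polytope.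
\<close>

definition root_polytope :: "('a \<times> 'a) set \<Rightarrow> ('a, real) poly_mapping set" where
  "root_polytope A =
     convex hull ((\<lambda>(t, h). Poly_Mapping.single h 1 - Poly_Mapping.single t 1) ` A)"

definition incident_arcs :: "'a pair_pre_digraph \<Rightarrow> 'a \<Rightarrow> ('a \<times> 'a) set" where
  "incident_arcs G x = {e \<in> parcs G. fst e = x \<or> snd e = x}"

text \<open>
  Edges are always represented by their arc \<open>(t, h)\<close>, also when viewed from the head:
  \<open>\<sigma> x e\<close> is the edge following \<open>e\<close> at \<open>x\<close>.
\<close>

definition ribbon_structure ::
  "'a pair_pre_digraph \<Rightarrow> ('a \<Rightarrow> 'a \<times> 'a \<Rightarrow> 'a \<times> 'a) \<Rightarrow> bool" where
  "ribbon_structure G \<sigma> \<longleftrightarrow>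
     (\<forall>x \<in> pverts G. incident_arcs G x \<noteq> {} \<longrightarrow>
        \<sigma> x permutes incident_arcs G x \<and> cyclic_on (\<sigma> x) (incident_arcs G x))"

definition is_basis :: "'a pair_pre_digraph \<Rightarrow> 'a \<times> ('a \<times> 'a) \<Rightarrow> bool" where
  "is_basis G b \<longleftrightarrow> fst b \<in> pverts G \<and> snd b \<in> incident_arcs G (fst b)"

definition other_end :: "'a \<times> 'a \<Rightarrow> 'a \<Rightarrow> 'a" where
  "other_end e x = (if fst e = x then snd e else fst e)"

definition tour_step ::
  "('a \<Rightarrow> 'a \<times> 'a \<Rightarrow> 'a \<times> 'a) \<Rightarrow> ('a \<times> 'a) set \<Rightarrow> 'a \<times> ('a \<times> 'a) \<Rightarrow> 'a \<times> ('a \<times> 'a)" where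
  "tour_step \<sigma> T = (\<lambda>(x, e).
     if e \<in> T then (other_end e x, \<sigma> (other_end e x) e) else (x, \<sigma> x e))"

text \<open>\<open>funpow_dist1 f b b\<close> is the least positive \<open>n\<close> such that \<open>(f ^^ n) b = b\<close>.\<close>

definition tour ::
  "('a \<Rightarrow> 'a \<times> 'a \<Rightarrow> 'a \<times> 'a) \<Rightarrow> 'a \<times> ('a \<times> 'a) \<Rightarrow> ('a \<times> 'a) set \<Rightarrow> ('a \<times> ('a \<times> 'a)) list" where
  "tour \<sigma> b T =
     map (\<lambda>n. (tour_step \<sigma> T ^^ n) b) [0..<funpow_dist1 (tour_step \<sigma> T) b b]"

definition precedes_in :: "'b list \<Rightarrow> 'b \<Rightarrow> 'b \<Rightarrow> bool" where
  "precedes_in xs u v \<longleftrightarrow> (\<exists>i j. i < j \<and> j < length xs \<and> xs ! i = u \<and> xs ! j = v)"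

definition jaeger_tree ::
  "'a pair_pre_digraph \<Rightarrow> ('a \<Rightarrow> 'a \<times> 'a \<Rightarrow> 'a \<times> 'a) \<Rightarrow> 'a \<times> ('a \<times> 'a) \<Rightarrow> ('a \<times> 'a) set \<Rightarrow> bool" where
  "jaeger_tree G \<sigma> b T \<longleftrightarrow>
     spanning_tree_arcs G T \<and>
     (\<forall>(t, h) \<in> parcs G - T. precedes_in (tour \<sigma> b T) (t, (t, h)) (h, (t, h)))"

definition jaeger_dissection ::
  "'a pair_pre_digraph \<Rightarrow> ('a \<Rightarrow> 'a \<times> 'a \<Rightarrow> 'a \<times> 'a) \<Rightarrow> 'a \<times> ('a \<times> 'a) \<Rightarrow> ('a, real) poly_mapping set set" where
  "jaeger_dissection G \<sigma> b = root_polytope ` {T. jaeger_tree G \<sigma> b T}"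

text \<open>
  The condition under which a dissection is a triangulation. The predicate \<open>triangulation\<close> of
  \<open>HOL-Analysis.Polytope\<close> is restricted to Euclidean spaces; it moreover contains that the members are
  finitely many simplices, which is part of being a dissection here.
\<close>

definition is_triangulation :: "'v::real_vector set set \<Rightarrow> bool" where
  "is_triangulation D \<longleftrightarrow>
     (\<forall>S \<in> D. \<forall>S' \<in> D. (S \<inter> S') face_of S \<and> (S \<inter> S') face_of S')"

end

theory Submission
  imports Defs
begin

text \<open>
  Two simplices of a Jaeger dissection do not meet in a common face as soon as the graph has a cycle
  whose arcs in one direction all lie in one Jaeger tree \<open>S\<close>, whose arcs in the other direction
  all lie in another Jaeger tree \<open>S'\<close>, and not all of the former lie in \<open>S'\<close>. In a
  semi-balanced graph both classes of arcs have the same barycentre, so this point lies in both simplices.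
  If the intersection were a face of the simplex of \<open>S\<close>, it would contain the vectors of the first
  class, one of which is outside the simplex of \<open>S'\<close>
  (\<open>crossing_circuit_not_common_face\<close>).

  Such pairs of trees are found in subdivisions. Take an undirected graph \<open>H\<close>, subdivide every
  edge, and direct both halves to the midpoint. Every spanning tree of \<open>H\<close>
  gives a Jaeger tree: keep both halves of its edges, and of every other edge cut the half that the tour
  of \<open>H\<close> meets first (\<open>jaeger_attached_tree\<close>). The reason is that the tour of
  the resulting tree follows the tour of \<open>H\<close>, with short detours to the midpoints.

  Let \<open>H\<close> be the complete bipartite graph with parts \<open>{v, x1, x2}\<close> and
  \<open>{y1, y2, y3}\<close>, where \<open>v\<close> is the vertex of \<open>H\<close> at the
  base. At each \<open>yi\<close> the three edges have one of two cyclic orders, so two of the three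
  vertices, say \<open>y1\<close> and \<open>y2\<close>, have the same one; exchanging
  \<open>x1\<close> and \<open>x2\<close> if necessary, it is \<open>v, x1, x2\<close>.
  The Hamiltonian path \<open>v, y1, x1, y2, x2, y3\<close> enters the square
  \<open>y1 x1 y2 x2\<close> at \<open>y1\<close>, and its tour meets the
  edge from \<open>x2\<close> to \<open>y1\<close> first at \<open>x2\<close>. So its Jaeger tree contains the
  subdivided square but for the half of that edge at \<open>x2\<close>. The path
  \<open>v, y2, x1, y1, x2, y3\<close> enters at \<open>y2\<close>, runs around the square the other
  way, and misses only the half at \<open>x2\<close> of the edge from \<open>x2\<close> to
  \<open>y2\<close>. The two missing halves point in opposite directions around the square, so each of the trees
  contains one direction class completely (\<open>two_trees_not_triangulation\<close>). The equal
  cyclic orders at \<open>y1\<close> and \<open>y2\<close> mean that the two tours enter the square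
  from different sides, which could not happen in a plane drawing.
\<close>

section \<open>Connectedness, cycles and levels in the underlying graph\<close>

lemma reachable_symmetrized_iff:
  "u \<rightarrow>\<^sup>*\<^bsub>with_proj (mk_symmetric (with_proj G))\<^esub> v \<longleftrightarrow>
     (u, v) \<in> rtrancl_on (pverts G) {(a, b). (a, b) \<in> parcs G \<or> (b, a) \<in> parcs G}"
proof -
  have "parcs (mk_symmetric (with_proj G)) = {(a, b). (a, b) \<in> parcs G \<or> (b, a) \<in> parcs G}"
    by (auto simp: mk_symmetric_def)
  moreover have "pverts (mk_symmetric (with_proj G)) = pverts G"
    by (simp add: mk_symmetric_def)
  ultimately show ?thesis by (simp add: reachable_def)
qed

text \<open>
  Spanning trees are recognised by a height function on the vertices: descending along lower neighbours
  connects every vertex to the root, and a cycle would have a highest vertex with two lower neighbours.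
\<close>

lemma connected_by_lower_neighbours:
  fixes k :: "'a \<Rightarrow> nat"
  assumes wf: "parcs G \<subseteq> pverts G \<times> pverts G" and r: "r \<in> pverts G"
    and lower: "\<And>v. v \<in> pverts G \<Longrightarrow> v \<noteq> r \<Longrightarrow>
      \<exists>u. ((u, v) \<in> parcs G \<or> (v, u) \<in> parcs G) \<and> k u < k v"
  shows "Digraph_Component.connected (with_proj G)"
proof -
  define R where "R = rtrancl_on (pverts G) {(a, b). (a, b) \<in> parcs G \<or> (b, a) \<in> parcs G}"
  have "(v, r) \<in> R \<and> (r, v) \<in> R" if "v \<in> pverts G" for v
    using that
  proof (induction "k v" arbitrary: v rule: less_induct)
    case less
    show ?case
    proof (cases "v = r")
      case True
      then show ?thesis using r by (simp add: R_def)
    next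
      case False
      with lower less.prems obtain u
        where u: "(u, v) \<in> parcs G \<or> (v, u) \<in> parcs G" "k u < k v" by blast
      then have "u \<in> pverts G" using wf by auto
      with less.hyps u have "(u, r) \<in> R \<and> (r, u) \<in> R" by blast
      moreover have "(u, v) \<in> R \<and> (v, u) \<in> R"
        unfolding R_def using u(1) \<open>u \<in> pverts G\<close> less.prems
        by (blast intro: rtrancl_on_into_rtrancl_on[OF rtrancl_on_refl])
      ultimately show ?thesis unfolding R_def by (blast intro: rtrancl_on_trans)
    qed
  qed
  then have "(u, v) \<in> R" if "u \<in> pverts G" "v \<in> pverts G" for u v
    using that unfolding R_def by (blast intro: rtrancl_on_trans)
  then show ?thesis
    using r unfolding connected_def strongly_connected_def reachable_symmetrized_iff R_def
    by (auto simp: mk_symmetric_def)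
qed

lemma pcas_nth:
  assumes "pcas u p v" "Suc i < length p"
  shows "fst (p ! Suc i) = snd (p ! i)"
  using assms
proof (induction p arbitrary: u i)
  case (Cons e p)
  then show ?case by (cases i; cases p) auto
qed simp

lemma underlying_cycle_cyclic:
  assumes "underlying_cycle G p" and i: "i < length p"
  shows "fst (p ! (Suc i mod length p)) = snd (p ! i)"
    and "distinct (map snd p)"
    and "p ! i \<in> parcs G \<or> prod.swap (p ! i) \<in> parcs G"
proof -
  obtain u where u: "pcas u p u" "distinct (tl (pawalk_verts u p))"
      "set p \<subseteq> parcs (mk_symmetric (with_proj G))"
    using assms
    by (auto simp: underlying_cycle_def pre_digraph.cycle_def pre_digraph.awalk_def
        cas_with_proj_eq awalk_verts_with_proj_eq)
  have "p \<noteq> []" using i by auto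
  have ends: "fst (p ! 0) = u" "snd (last p) = u"
  proof -
    show "fst (p ! 0) = u" using u(1) \<open>p \<noteq> []\<close> by (cases p) auto
    have "snd (last p) = v" if "pcas w p v" "p \<noteq> []" for w v p
      using that
    proof (induction p arbitrary: w)
      case (Cons e p)
      show ?case
      proof (cases "p = []")
        case False
        have "pcas (snd e) p v" using Cons.prems by simp
        from Cons.IH[OF this False] show ?thesis using False by simp
      qed (use Cons.prems in simp)
    qed simp
    from this[OF u(1) \<open>p \<noteq> []\<close>] show "snd (last p) = u" .
  qed
  show "fst (p ! (Suc i mod length p)) = snd (p ! i)"
  proof (cases "Suc i < length p")
    case True
    then show ?thesis using pcas_nth[OF u(1)] by simp
  next
    case False
    then have *: "Suc i = length p" using i by simp
    have "p ! i = last p"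
      using \<open>p \<noteq> []\<close> by (simp add: last_conv_nth flip: *)
    then show ?thesis using ends * by simp
  qed
  have "tl (pawalk_verts w p) = map snd p" if "pcas w p v" for w v p
    using that
  proof (induction p arbitrary: w)
    case (Cons e p)
    then show ?case by (cases p) auto
  qed simp
  from this[OF u(1)] u(2) show "distinct (map snd p)" by simp
  show "p ! i \<in> parcs G \<or> prod.swap (p ! i) \<in> parcs G"
    using u(3) nth_mem[OF i] by (fastforce simp: mk_symmetric_def)
qed

lemma no_cycle_by_unique_lower_neighbours:
  fixes k :: "'a \<Rightarrow> nat"
  assumes unique: "\<And>v u w. (u, v) \<in> parcs G \<or> (v, u) \<in> parcs G \<Longrightarrow>
      (w, v) \<in> parcs G \<or> (v, w) \<in> parcs G \<Longrightarrow> k u \<le> k v \<Longrightarrow> k w \<le> k v \<Longrightarrow> u = w"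
  shows "\<not> underlying_cycle G p"
proof
  assume cyc: "underlying_cycle G p"
  define n where "n = length p"
  have n: "3 \<le> n" using cyc by (simp add: underlying_cycle_def n_def)
  note cyclic = underlying_cycle_cyclic[OF cyc, folded n_def]
  define M where "M = Max ((\<lambda>i. k (snd (p ! i))) ` {..<n})"
  have "M \<in> (\<lambda>i. k (snd (p ! i))) ` {..<n}"
    unfolding M_def using n by (intro Max_in) (auto simp: lessThan_empty_iff)
  moreover have "k (snd (p ! i)) \<le> M" if "i < n" for i
    unfolding M_def using that by (intro Max_ge) auto
  ultimately obtain b where b: "b < n" "\<And>i. i < n \<Longrightarrow> k (snd (p ! i)) \<le> k (snd (p ! b))"
    by auto
  \<comment> \<open>The walk reaches its highest vertex by \<open>p ! b\<close> from the head of \<open>p ! a\<close>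
    and leaves it by \<open>p ! c\<close>; length three makes the two neighbours different.\<close>
  define a c where "a = (if b = 0 then n - 1 else b - 1)" and "c = Suc b mod n"
  have a: "a < n" "Suc a mod n = b" using b(1) n by (auto simp: a_def)
  have c: "c < n" "a \<noteq> c"
    using b(1) n by (auto simp: a_def c_def mod_Suc split: if_splits)
  have "fst (p ! b) = snd (p ! a)" "fst (p ! c) = snd (p ! b)"
    using cyclic(1)[OF a(1)] a(2) cyclic(1)[OF b(1)] by (auto simp: c_def)
  then have "snd (p ! a) = snd (p ! c)"
    using unique[of "snd (p ! a)" "snd (p ! b)" "snd (p ! c)"]
      cyclic(3)[OF b(1)] cyclic(3)[OF c(1)] b(2)[OF a(1)] b(2)[OF c(1)]
    by (cases "p ! b"; cases "p ! c") auto
  then show False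
    using cyclic(2)[OF b(1)] a(1) c n_def by (auto simp: distinct_conv_nth)
qed

text \<open>
  Along a walk the forward arcs minus the backward arcs count the change of level, which is zero on a
  closed walk.
\<close>

lemma semi_balanced_by_levels:
  fixes l :: "'a \<Rightarrow> int"
  assumes levels: "\<And>t h. (t, h) \<in> parcs G \<Longrightarrow> l h = l t + 1"
  shows "semi_balanced G"
  unfolding semi_balanced_def
proof (intro allI impI)
  fix p assume cyc: "underlying_cycle G p"
  define fw bw where "fw = filter (\<lambda>(x, y). (x, y) \<in> parcs G)"
    and "bw = filter (\<lambda>(x, y). (y, x) \<in> parcs G)"
  have "int (length (fw p)) - int (length (bw p)) = l v - l u"
    if "pcas u p v" "set p \<subseteq> parcs (mk_symmetric (with_proj G))" for u v p
    using that
  proof (induction p arbitrary: u)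
    case Nil
    then show ?case by (simp add: fw_def bw_def)
  next
    case (Cons e p)
    obtain a b where e: "e = (a, b)" by (cases e)
    have "(a, b) \<in> parcs G \<or> (b, a) \<in> parcs G"
      using Cons.prems(2) e by (auto simp: mk_symmetric_def)
    then have "int (if (a, b) \<in> parcs G then 1 else 0) - int (if (b, a) \<in> parcs G then 1 else 0)
        = l b - l a"
      using levels[of a b] levels[of b a] by (cases "(a, b) \<in> parcs G") (force+)
    moreover have "int (length (fw p)) - int (length (bw p)) = l v - l b"
      using Cons e by auto
    ultimately show ?case
      using Cons.prems(1) e by (simp add: fw_def bw_def split: if_splits)
  qed
  note count = this
  obtain u where "pcas u p u" "set p \<subseteq> parcs (mk_symmetric (with_proj G))"
    using cyc by (auto simp: underlying_cycle_def pre_digraph.cycle_def pre_digraph.awalk_def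
        cas_with_proj_eq)
  from count[OF this] show "length (filter (\<lambda>(x, y). (x, y) \<in> parcs G) p) =
      length (filter (\<lambda>(x, y). (y, x) \<in> parcs G) p)"
    by (simp add: fw_def bw_def)
qed

section \<open>Circuits that cross two simplices of a root polytope\<close>

definition edge_vector :: "'a \<times> 'a \<Rightarrow> ('a, real) poly_mapping" where
  "edge_vector = (\<lambda>(t, h). Poly_Mapping.single h 1 - Poly_Mapping.single t 1)"

lemma root_polytope_eq: "root_polytope A = convex hull (edge_vector ` A)"
  by (simp add: root_polytope_def edge_vector_def)

lemma lookup_scaleR:
  "Poly_Mapping.lookup (c *\<^sub>R x) i = c *\<^sub>R Poly_Mapping.lookup (x :: ('a, real) poly_mapping) i"
proof -
  have "finite {i. c *\<^sub>R Poly_Mapping.lookup x i \<noteq> 0}"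
    by (rule finite_subset[OF _ finite_lookup[of x]]) auto
  then show ?thesis by (simp add: scaleR_poly_mapping_def lookup_Abs_poly_mapping)
qed

text \<open>
  The vector of an arc is a vertex of the root polytope of any set of arcs that contains it: the difference of
  the coordinates at its ends has the value 2 there and at most 1 on the vectors of all other arcs.
\<close>

lemma edge_vector_in_root_polytopeD:
  assumes "edge_vector (t, h) \<in> root_polytope A" and "t \<noteq> h"
  shows "(t, h) \<in> A"
proof (rule ccontr)
  assume notin: "(t, h) \<notin> A"
  let ?d = "\<lambda>x :: ('a, real) poly_mapping. Poly_Mapping.lookup x h - Poly_Mapping.lookup x t"
  have "convex {x. ?d x \<le> 1}"
  proof (rule convexI)
    fix x y :: "('a, real) poly_mapping" and u v :: real
    assume *: "x \<in> {x. ?d x \<le> 1}" "y \<in> {x. ?d x \<le> 1}" "0 \<le> u" "0 \<le> v" "u + v = 1"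
    have "?d (u *\<^sub>R x + v *\<^sub>R y) = u * ?d x + v * ?d y"
      by (simp add: lookup_add lookup_scaleR algebra_simps)
    also have "\<dots> \<le> u * 1 + v * 1"
      using * by (intro add_mono mult_left_mono) auto
    finally show "u *\<^sub>R x + v *\<^sub>R y \<in> {x. ?d x \<le> 1}" using * by simp
  qed
  moreover have "edge_vector ` A \<subseteq> {x. ?d x \<le> 1}"
    using notin \<open>t \<noteq> h\<close>
    by (auto simp: edge_vector_def lookup_minus lookup_single when_def)
  ultimately have "root_polytope A \<subseteq> {x. ?d x \<le> 1}"
    unfolding root_polytope_eq by (intro hull_minimal)
  with assms show False
    by (auto simp: edge_vector_def lookup_minus lookup_single when_def)
qed

text \<open>
  The average of the points lies on the segment from any one of them to the average of the others, so a face
  through the average contains this segment.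
\<close>

lemma face_of_contains_summands:
  fixes y :: "'i \<Rightarrow> 'v::real_vector"
  assumes F: "F face_of S" and S: "convex S" and I: "finite I" "i \<in> I"
    and y: "\<And>j. j \<in> I \<Longrightarrow> y j \<in> S" and avg: "(\<Sum>j\<in>I. y j /\<^sub>R card I) \<in> F"
  shows "y i \<in> F"
proof (cases "I = {i}")
  case True
  then show ?thesis using avg by simp
next
  case False
  define J where "J = I - {i}"
  define z where "z = (\<Sum>j\<in>J. y j /\<^sub>R card J)"
  have J: "finite J" "J \<noteq> {}" "card I = Suc (card J)"
    using I False card.remove[OF I] by (auto simp: J_def)
  then have cJ: "card J > 0" by (simp add: card_gt_0_iff)
  have "z \<in> S" unfolding z_def
    using S J cJ y by (intro convex_sum) (auto simp: J_def)
  have "(\<Sum>j\<in>I. y j /\<^sub>R card I) = y i /\<^sub>R card I + (\<Sum>j\<in>J. y j /\<^sub>R card I)"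
    using I by (simp add: J_def sum.remove)
  also have "(\<Sum>j\<in>J. y j /\<^sub>R card I) = (card J / card I) *\<^sub>R z"
    using cJ by (simp add: z_def scaleR_sum_right field_simps)
  finally have avg': "(\<Sum>j\<in>I. y j /\<^sub>R card I) =
      (1 - card J / card I) *\<^sub>R y i + (card J / card I) *\<^sub>R z"
    using J by (simp add: field_simps)
  show ?thesis
  proof (cases "y i = z")
    case True
    then show ?thesis using avg avg' by (simp add: scaleR_left_distrib[symmetric])
  next
    case False
    then have "(\<Sum>j\<in>I. y j /\<^sub>R card I) \<in> open_segment (y i) z"
      unfolding avg' in_segment using J cJ by (auto intro!: exI[of _ "card J / card I"])
    then show ?thesis
      using F y[OF I(2)] \<open>z \<in> S\<close> avg unfolding face_of_def by blast
  qed
qed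

text \<open>
  Here \<open>P\<close> and \<open>N\<close> stand for the two direction classes of a balanced cycle,
  of which only the linear relation matters. The common barycentre puts all of \<open>P\<close> into
  the intersection, if that is a face.
\<close>

lemma crossing_circuit_not_common_face:
  assumes P: "finite P" "P \<subseteq> T" and N: "finite N" "N \<subseteq> T'" "N \<noteq> {}"
    and card: "card P = card N"
    and sum: "(\<Sum>e\<in>P. edge_vector e) = (\<Sum>e\<in>N. edge_vector e)"
    and e: "(t, h) \<in> P" "(t, h) \<notin> T'" "t \<noteq> h"
  shows "\<not> (root_polytope T \<inter> root_polytope T') face_of root_polytope T"
proof
  assume face: "(root_polytope T \<inter> root_polytope T') face_of root_polytope T"
  have P_T: "edge_vector e \<in> root_polytope T" if "e \<in> P" for e
    using that P by (auto simp: root_polytope_eq intro: hull_inc)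
  have N_T': "edge_vector e \<in> root_polytope T'" if "e \<in> N" for e
    using that N by (auto simp: root_polytope_eq intro: hull_inc)
  have "P \<noteq> {}" using e by auto
  have convex: "convex (root_polytope A)" for A :: "('a \<times> 'a) set"
    by (simp add: root_polytope_eq)
  have "(\<Sum>e\<in>P. edge_vector e /\<^sub>R card P) \<in> root_polytope T"
    using P \<open>P \<noteq> {}\<close> P_T by (intro convex_sum convex) auto
  moreover have "(\<Sum>e\<in>N. edge_vector e /\<^sub>R card N) \<in> root_polytope T'"
    using N N_T' by (intro convex_sum convex) auto
  ultimately have "(\<Sum>e\<in>P. edge_vector e /\<^sub>R card P) \<in> root_polytope T \<inter> root_polytope T'"
    using sum card by (simp add: scaleR_sum_right[symmetric])
  then have "edge_vector (t, h) \<in> root_polytope T \<inter> root_polytope T'"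
    using face_of_contains_summands[OF face convex P(1) e(1)] P_T by blast
  then show False using edge_vector_in_root_polytopeD e by fastforce
qed

section \<open>Tours as orbits\<close>

definition orbit_list :: "('s \<Rightarrow> 's) \<Rightarrow> 's \<Rightarrow> nat \<Rightarrow> 's list" where
  "orbit_list f s n = map (\<lambda>i. (f ^^ i) s) [0..<n]"

lemma length_orbit_list [simp]: "length (orbit_list f s n) = n"
  and nth_orbit_list [simp]: "i < n \<Longrightarrow> orbit_list f s n ! i = (f ^^ i) s"
  by (simp_all add: orbit_list_def)

lemma orbit_list_Suc: "orbit_list f s (Suc n) = orbit_list f s n @ [(f ^^ n) s]"
  and orbit_list_0: "orbit_list f s 0 = []"
  by (simp_all add: orbit_list_def)

lemma orbit_list_add: "orbit_list f s (m + n) = orbit_list f s m @ orbit_list f ((f ^^ m) s) n"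
proof (induction n)
  case (Suc n)
  then show ?case by (simp add: orbit_list_Suc funpow_add add.commute[of m n])
qed (simp add: orbit_list_0)

text \<open>
  A tour ends at the first return to the base. If the states before some return are pairwise
  distinct, this is the first one.
\<close>

lemma tour_eq_orbit_list:
  assumes n: "0 < n" and return: "(tour_step \<sigma> T ^^ n) b = b"
    and distinct: "distinct (orbit_list (tour_step \<sigma> T) b n)"
  shows "tour \<sigma> b T = orbit_list (tour_step \<sigma> T) b n"
proof -
  let ?f = "tour_step \<sigma> T"
  define d where "d = funpow_dist1 ?f b b"
  have "0 < d" by (simp add: d_def)
  have "(?f ^^ d) b = b" unfolding d_def using funpow_dist1_prop1[OF return n] .
  have "\<not> n < d" using funpow_dist1_least[OF n, of ?f b b] return unfolding d_def by blast
  moreover have "\<not> d < n"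
  proof
    assume "d < n"
    then have "orbit_list ?f b n ! d = orbit_list ?f b n ! 0"
      using n \<open>(?f ^^ d) b = b\<close> by simp
    then show False
      using distinct \<open>d < n\<close> \<open>0 < d\<close> n by (simp only: nth_eq_iff_index_eq length_orbit_list)
  qed
  ultimately show ?thesis by (simp add: tour_def orbit_list_def d_def)
qed

text \<open>
  A base that is one step earlier only moves the last entry of the tour to the front. This reduces
  a base at a midpoint to a base at a vertex of the graph before its subdivision.
\<close>

lemma tour_shift_back:
  assumes "0 < n" and "(tour_step \<sigma> T ^^ n) b = b"
    and "distinct (orbit_list (tour_step \<sigma> T) b n)"
  defines "L \<equiv> orbit_list (tour_step \<sigma> T) b n"
  shows "tour \<sigma> (last L) T = last L # butlast L"
proof -
  let ?f = "tour_step \<sigma> T"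
  obtain m where m: "n = Suc m" using assms(1) by (cases n) auto
  have L: "L = orbit_list ?f b m @ [(?f ^^ m) b]" by (simp add: L_def m orbit_list_Suc)
  have 1: "(?f ^^ 1) (last L) = b" using assms(2) L m by simp
  have "orbit_list ?f (last L) n = orbit_list ?f (last L) (1 + m)" by (simp add: m)
  also have "\<dots> = last L # butlast L"
    unfolding orbit_list_add 1 by (simp add: L orbit_list_Suc orbit_list_0)
  finally have eq: "orbit_list ?f (last L) n = last L # butlast L" .
  have "(?f ^^ n) (last L) = (?f ^^ m) ((?f ^^ 1) (last L))"
    by (simp add: m funpow_swap1)
  also have "\<dots> = last L" unfolding 1 by (simp add: L)
  finally have "(?f ^^ n) (last L) = last L" .
  moreover have "distinct (last L # butlast L)"
    using assms(3) L by (simp add: m orbit_list_Suc)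
  ultimately show ?thesis
    using tour_eq_orbit_list[OF assms(1), of \<sigma> T "last L"] by (simp add: eq)
qed

lemma precedes_inI: "precedes_in (xs @ u # ys @ v # zs) u v"
  unfolding precedes_in_def
  by (rule exI[of _ "length xs"], rule exI[of _ "length xs + Suc (length ys)"])
    (simp add: nth_append)

section \<open>The tour of a spanning tree of a subdivided graph\<close>

text \<open>
  The assumptions say that \<open>G\<close> arises from an undirected graph \<open>H\<close> by subdividing
  every edge and directing both halves to the midpoint. The tails are the vertices of
  \<open>H\<close>, the heads are the midpoints, and an arc is a dart of \<open>H\<close>: an edge of
  \<open>H\<close> seen from one of its ends. In these terms \<open>turn\<close> below is the rotation at the
  vertices of \<open>H\<close>, and \<open>opp\<close> exchanges the two darts of an edge, being the only
  possible rotation at a midpoint.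
\<close>

locale ribbon_subdivision =
  fixes G :: "'a pair_pre_digraph" and \<sigma> :: "'a \<Rightarrow> 'a \<times> 'a \<Rightarrow> 'a \<times> 'a"
  assumes finite_arcs: "finite (parcs G)"
    and verts: "pverts G = fst ` parcs G \<union> snd ` parcs G"
    and bipartite: "fst ` parcs G \<inter> snd ` parcs G = {}"
    and two_halves: "e \<in> parcs G \<Longrightarrow> card {d \<in> parcs G. snd d = snd e} = 2"
    and ribbon: "ribbon_structure G \<sigma>"
begin

abbreviation "A \<equiv> parcs G"

definition turn :: "'a \<times> 'a \<Rightarrow> 'a \<times> 'a" where
  "turn e = \<sigma> (fst e) e"

definition opp :: "'a \<times> 'a \<Rightarrow> 'a \<times> 'a" where
  "opp e = \<sigma> (snd e) e"

lemma fst_neq_snd: "d \<in> A \<Longrightarrow> e \<in> A \<Longrightarrow> fst d \<noteq> snd e"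
  using bipartite by blast

lemma incident_fst: "e \<in> A \<Longrightarrow> incident_arcs G (fst e) = {d \<in> A. fst d = fst e}"
  and incident_snd: "e \<in> A \<Longrightarrow> incident_arcs G (snd e) = {d \<in> A. snd d = snd e}"
  using fst_neq_snd by (fastforce simp: incident_arcs_def)+

lemma rotation:
  assumes "x \<in> pverts G" "e \<in> incident_arcs G x"
  shows "\<sigma> x permutes incident_arcs G x" "cyclic_on (\<sigma> x) (incident_arcs G x)"
  using ribbon assms unfolding ribbon_structure_def by auto

lemma rotation_fst:
  assumes "e \<in> A"
  shows "\<sigma> (fst e) permutes {d \<in> A. fst d = fst e}"
    and "cyclic_on (\<sigma> (fst e)) {d \<in> A. fst d = fst e}"
  using rotation[of "fst e" e] assms incident_fst[OF assms] verts by auto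

lemma rotation_snd:
  assumes "e \<in> A"
  shows "\<sigma> (snd e) permutes {d \<in> A. snd d = snd e}"
    and "cyclic_on (\<sigma> (snd e)) {d \<in> A. snd d = snd e}"
  using rotation[of "snd e" e] assms incident_snd[OF assms] verts by auto

lemma turn_in: "e \<in> A \<Longrightarrow> turn e \<in> A" and fst_turn [simp]: "e \<in> A \<Longrightarrow> fst (turn e) = fst e"
  using permutes_in_image[OF rotation_fst(1), of e e] by (auto simp: turn_def)

lemma turn_inj: "d \<in> A \<Longrightarrow> e \<in> A \<Longrightarrow> turn d = turn e \<Longrightarrow> d = e"
  using fst_turn[of d] fst_turn[of e] permutes_inj[OF rotation_fst(1), of e]
  by (auto simp: turn_def dest: injD)

lemma opp_in: "e \<in> A \<Longrightarrow> opp e \<in> A" and snd_opp [simp]: "e \<in> A \<Longrightarrow> snd (opp e) = snd e"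
  using permutes_in_image[OF rotation_snd(1), of e e] by (auto simp: opp_def)

lemma opp_neq: assumes "e \<in> A" shows "opp e \<noteq> e"
proof
  assume "opp e = e"
  then have "orbit (\<sigma> (snd e)) e = {e}" by (simp add: opp_def orbit_eq_singleton_iff)
  moreover have "orbit (\<sigma> (snd e)) e = {d \<in> A. snd d = snd e}"
    using orbit_cyclic_eq3[OF rotation_snd(2)[OF assms]] assms by simp
  ultimately show False using two_halves[OF assms] by simp
qed

lemma halves: assumes "e \<in> A" shows "{d \<in> A. snd d = snd e} = {e, opp e}"
proof -
  have "{e, opp e} \<subseteq> {d \<in> A. snd d = snd e}" using assms opp_in by auto
  moreover have "card {e, opp e} = 2" using opp_neq[OF assms] by simp
  moreover have "finite {d \<in> A. snd d = snd e}" using finite_arcs by simp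
  ultimately show ?thesis
    using card_subset_eq[of "{d \<in> A. snd d = snd e}" "{e, opp e}"] two_halves[OF assms] by simp
qed

lemma same_head: "d \<in> A \<Longrightarrow> e \<in> A \<Longrightarrow> snd d = snd e \<Longrightarrow> d = e \<or> d = opp e"
  using halves[of e] by blast

lemma opp_opp [simp]: "e \<in> A \<Longrightarrow> opp (opp e) = e"
  using same_head[OF opp_in[OF opp_in[of e]], of e] opp_neq[OF opp_in[of e]] snd_opp[of e]
    snd_opp[OF opp_in[of e]] same_head[of "opp (opp e)" e] opp_in[of e] opp_in[of "opp e"]
  by argo

lemma opp_eqI: "d \<in> A \<Longrightarrow> e \<in> A \<Longrightarrow> snd d = snd e \<Longrightarrow> d \<noteq> e \<Longrightarrow> opp d = e"
  using same_head[of e d] by auto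

end

text \<open>
  A spanning tree of \<open>H\<close> with root \<open>r\<close>: the dart \<open>\<pi> p\<close> leads from
  \<open>p\<close> to its parent, and \<open>k\<close> is a height that decreases along it.
\<close>

locale subdivision_tree = ribbon_subdivision G \<sigma>
  for G :: "'a pair_pre_digraph" and \<sigma> +
  fixes r :: 'a and k :: "'a \<Rightarrow> nat" and \<pi> :: "'a \<Rightarrow> 'a \<times> 'a"
  assumes root: "r \<in> fst ` parcs G"
    and parent: "p \<in> fst ` parcs G \<Longrightarrow> p \<noteq> r \<Longrightarrow>
      \<pi> p \<in> parcs G \<and> fst (\<pi> p) = p \<and> k (fst (opp (\<pi> p))) < k p"
begin

definition tree_arcs :: "('a \<times> 'a) set" where
  "tree_arcs = (\<Union>p \<in> fst ` A - {r}. {\<pi> p, opp (\<pi> p)})"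

text \<open>
  The tour of the tree in \<open>H\<close> is the iteration of \<open>dart_step\<close>: cross the edge if it
  belongs to the tree, then turn.
\<close>

definition cross :: "'a \<times> 'a \<Rightarrow> 'a \<times> 'a" where
  "cross e = (if e \<in> tree_arcs then opp e else e)"

definition dart_step :: "'a \<times> 'a \<Rightarrow> 'a \<times> 'a" where
  "dart_step e = (if e \<in> A then turn (cross e) else e)"

lemma tree_arcs_subset: "tree_arcs \<subseteq> A"
proof
  fix e assume "e \<in> tree_arcs"
  then obtain p where "p \<in> fst ` A" "p \<noteq> r" "e = \<pi> p \<or> e = opp (\<pi> p)"
    unfolding tree_arcs_def by blast
  then show "e \<in> A" using parent[of p] opp_in by blast
qed

lemma opp_tree_arcs: assumes "e \<in> tree_arcs" shows "opp e \<in> tree_arcs"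
proof -
  obtain p where p: "p \<in> fst ` A" "p \<noteq> r" "e = \<pi> p \<or> e = opp (\<pi> p)"
    using assms unfolding tree_arcs_def by blast
  then have "opp e = opp (\<pi> p) \<or> opp e = \<pi> p" using parent[of p] opp_opp by blast
  then show ?thesis using p unfolding tree_arcs_def by blast
qed

lemma opp_tree_arcs_iff: "e \<in> A \<Longrightarrow> opp e \<in> tree_arcs \<longleftrightarrow> e \<in> tree_arcs"
  using opp_tree_arcs opp_opp by metis

lemma parent_in_tree_arcs: "p \<in> fst ` A \<Longrightarrow> p \<noteq> r \<Longrightarrow> \<pi> p \<in> tree_arcs"
  by (auto simp: tree_arcs_def)

lemma tree_arcs_cases:
  assumes "e \<in> tree_arcs"
  obtains (up) "fst e \<noteq> r" "e = \<pi> (fst e)" "k (fst (opp e)) < k (fst e)"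
  | (down) "fst (opp e) \<noteq> r" "opp e = \<pi> (fst (opp e))" "k (fst e) < k (fst (opp e))"
proof -
  obtain p where p: "p \<in> fst ` A" "p \<noteq> r" "e = \<pi> p \<or> e = opp (\<pi> p)"
    using assms by (auto simp: tree_arcs_def)
  note parent[OF p(1,2)]
  with p that show thesis by (metis opp_opp)
qed

lemma cross_in: "e \<in> A \<Longrightarrow> cross e \<in> A"
  by (simp add: cross_def opp_in)

lemma cross_cross: "e \<in> A \<Longrightarrow> cross (cross e) = e"
  by (simp add: cross_def opp_tree_arcs_iff)

lemma dart_step_in: "e \<in> A \<Longrightarrow> dart_step e \<in> A"
  by (simp add: dart_step_def turn_in cross_in)

lemma dart_step_permutes: "dart_step permutes A"
proof (rule bij_imp_permutes)
  have inj: "inj_on dart_step A"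
  proof (rule inj_onI)
    fix d e assume de: "d \<in> A" "e \<in> A" "dart_step d = dart_step e"
    then have "cross d = cross e"
      using turn_inj[OF cross_in cross_in] by (simp add: dart_step_def)
    then show "d = e" using cross_cross[OF de(1)] cross_cross[OF de(2)] by metis
  qed
  moreover have "dart_step ` A = A"
    using inj dart_step_in finite_arcs by (intro endo_inj_surj) auto
  ultimately show "bij_betw dart_step A A" by (simp add: bij_betw_def)
qed (simp add: dart_step_def)

lemma permutation_dart_step: "permutation dart_step"
  using dart_step_permutes finite_arcs by (rule permutes_imp_permutation[rotated])

definition linked :: "'a \<times> 'a \<Rightarrow> 'a \<times> 'a \<Rightarrow> bool" where
  "linked d e \<longleftrightarrow> e \<in> orbit dart_step d"

lemma linked_refl: "linked e e"
  unfolding linked_def by (rule permutation_self_in_orbit[OF permutation_dart_step])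

lemma linked_sym: "linked d e \<Longrightarrow> linked e d"
  unfolding linked_def by (rule orbit_swap[OF permutation_self_in_orbit[OF permutation_dart_step]])

lemma linked_trans: "linked d e \<Longrightarrow> linked e e' \<Longrightarrow> linked d e'"
  unfolding linked_def by (rule orbit_trans)

lemma linked_dart_step: "linked e (dart_step e)"
  unfolding linked_def by (rule orbit.base)

text \<open>
  Induction from the leaves to the root. A step from a dart outside the tree is a turn; from the
  dart to a child \<open>q\<close> the tour enters \<open>q\<close>, by induction gets to the dart back, and
  comes out one turn further. So a dart is linked to the next one at its vertex, except perhaps for the dart
  to the parent, and removing one link from a cyclic order does not disconnect it.
\<close>

lemma linked_at_vertex:
  assumes "d \<in> A" "e \<in> A" "fst d = fst e"
  shows "linked d e"
proof -
  define K where "K = Max (k ` fst ` A)"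
  have K: "k p \<le> K" if "p \<in> fst ` A" for p
    unfolding K_def using that finite_arcs by (intro Max_ge) auto
  have "\<forall>d\<in>A. \<forall>e\<in>A. fst d = p \<longrightarrow> fst e = p \<longrightarrow> linked d e" if "p \<in> fst ` A" for p
    using that
  proof (induction "K - k p" arbitrary: p rule: less_induct)
    case less
    have step: "linked e (turn e)" if e: "e \<in> A" "fst e = p" "p \<noteq> r \<Longrightarrow> e \<noteq> \<pi> p" for e
    proof (cases "e \<in> tree_arcs")
      case False
      then show ?thesis using linked_dart_step[of e] e by (simp add: dart_step_def cross_def)
    next
      case True
      let ?q = "fst (opp e)"
      have "k p < k ?q" using True e by (cases rule: tree_arcs_cases) auto
      moreover have "?q \<in> fst ` A" using e opp_in by blast
      ultimately have "linked (dart_step e) (opp e)"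
        using less.hyps[of ?q] K[of ?q] e True by (auto simp: dart_step_def cross_def turn_in opp_in)
      moreover have "dart_step (opp e) = turn e"
        using e True opp_tree_arcs by (simp add: dart_step_def cross_def opp_in)
      ultimately show ?thesis using linked_dart_step linked_trans by metis
    qed
    obtain d0 where d0: "d0 \<in> A" "fst d0 = p" "p \<noteq> r \<Longrightarrow> d0 = \<pi> p"
      using less.prems parent[OF less.prems] by (cases "p = r") auto
    \<comment> \<open>The missing link may start at \<open>d0\<close>, so the cyclic order is run through from the dart
      after \<open>d0\<close>.\<close>
    have "linked (turn d0) ((\<sigma> p ^^ n) (turn d0)) \<and> (\<sigma> p ^^ n) (turn d0) \<in> A
        \<and> fst ((\<sigma> p ^^ n) (turn d0)) = p" for n
    proof (induction n)
      case 0
      then show ?case using d0 by (simp add: linked_refl turn_in)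
    next
      case (Suc n)
      let ?x = "(\<sigma> p ^^ n) (turn d0)"
      have x: "linked (turn d0) ?x" "?x \<in> A" "fst ?x = p" using Suc by auto
      then have eq: "(\<sigma> p ^^ Suc n) (turn d0) = turn ?x" by (simp add: turn_def)
      have "linked (turn d0) (turn ?x)"
      proof (cases "?x = d0")
        case True
        then show ?thesis by (simp add: linked_refl)
      next
        case False
        then show ?thesis using step[OF x(2,3)] d0(3) x(1) linked_trans by blast
      qed
      then show ?case using eq x turn_in by simp
    qed
    moreover have "\<exists>n. e = (\<sigma> p ^^ n) (turn d0)" if "e \<in> A" "fst e = p" for e
    proof -
      have "e \<in> orbit (\<sigma> p) (turn d0)"
        using orbit_cyclic_eq3[OF rotation_fst(2)[OF d0(1)], of "turn d0"] d0 that
        by (simp add: turn_in)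
      then show ?thesis by (auto simp: orbit_altdef)
    qed
    ultimately have "linked (turn d0) e" if "e \<in> A" "fst e = p" for e
      using that by metis
    then show ?case using linked_sym linked_trans by blast
  qed
  then show ?thesis using assms by blast
qed

text \<open>
  The tour of a spanning tree passes through all darts: the tree edges link the vertices to the root.
\<close>

lemma orbit_dart_step: "e \<in> A \<Longrightarrow> orbit dart_step e = A"
proof -
  obtain e0 where e0: "e0 \<in> A" "fst e0 = r" using root by auto
  have to_root: "linked e e0" if "e \<in> A" for e
    using that
  proof (induction "k (fst e)" arbitrary: e rule: less_induct)
    case less
    show ?case
    proof (cases "fst e = r")
      case True
      then show ?thesis using linked_at_vertex less.prems e0 by simp
    next
      case False
      let ?d = "\<pi> (fst e)"
      have d: "?d \<in> A" "fst ?d = fst e" "k (fst (opp ?d)) < k (fst e)" "?d \<in> tree_arcs"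
        using parent[of "fst e"] parent_in_tree_arcs[of "fst e"] less.prems False by auto
      then have hd: "dart_step ?d \<in> A" "fst (dart_step ?d) = fst (opp ?d)"
        by (simp_all add: dart_step_def cross_def turn_in opp_in)
      have "linked e ?d" using linked_at_vertex less.prems d by simp
      moreover have "linked (dart_step ?d) e0" using less.hyps[of "dart_step ?d"] hd d by simp
      ultimately show ?thesis using linked_dart_step linked_trans by blast
    qed
  qed
  show "orbit dart_step e = A" if "e \<in> A"
  proof
    show "orbit dart_step e \<subseteq> A" using permutes_orbit_subset[OF dart_step_permutes that] .
    show "A \<subseteq> orbit dart_step e"
      using to_root[OF that] to_root linked_sym linked_trans unfolding linked_def by blast
  qed
qed

end

section \<open>Jaeger trees of subdivided graphs\<close>

context subdivision_tree
begin

text \<open>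
  The spanning trees of the subdivision that induce the given tree of \<open>H\<close>: the midpoint of any
  other edge is attached to one of its two ends.
\<close>

definition attachment :: "('a \<times> 'a) set \<Rightarrow> bool" where
  "attachment S \<longleftrightarrow> tree_arcs \<subseteq> S \<and> S \<subseteq> A \<and> (\<forall>e\<in>A - tree_arcs. e \<in> S \<longleftrightarrow> opp e \<notin> S)"

lemma spanning_tree_attachment:
  assumes "attachment T"
  shows "spanning_tree_arcs G T"
proof -
  have T: "tree_arcs \<subseteq> T" "T \<subseteq> A" and one: "\<And>e. e \<in> A - tree_arcs \<Longrightarrow> e \<in> T \<longleftrightarrow> opp e \<notin> T"
    using assms by (auto simp: attachment_def)
  \<comment> \<open>A height for \<open>no_cycle_by_unique_lower_neighbours\<close>: a midpoint lies just above its lower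
    neighbour, hence below the upper one if it has two, and above its only neighbour if it is a leaf.\<close>
  define l where "l m = Min ((\<lambda>e. k (fst e)) ` {e \<in> T. snd e = m})" for m
  define K where "K v = (if v \<in> fst ` A then 2 * k v else 2 * l v + 1)" for v
  have K_fst: "K (fst e) = 2 * k (fst e)" and K_snd: "K (snd e) = 2 * l (snd e) + 1" if "e \<in> A" for e
    using that bipartite by (auto simp: K_def)
  have fin: "finite {e \<in> T. snd e = m}" for m
    using finite_subset[OF T(2) finite_arcs] by simp
  have l_le: "l (snd e) \<le> k (fst e)" if "e \<in> T" for e
    unfolding l_def using that fin by (intro Min_le) auto
  have l_attained: "\<exists>d\<in>T. snd d = snd e \<and> k (fst d) = l (snd e)" if "e \<in> T" for e
  proof -
    have "e \<in> {d \<in> T. snd d = snd e}" using that by simp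
    then have "l (snd e) \<in> (\<lambda>e. k (fst e)) ` {d \<in> T. snd d = snd e}"
      unfolding l_def using fin[of "snd e"] by (intro Min_in) blast+
    then show ?thesis by auto
  qed
  have both: "e \<in> tree_arcs" if "e \<in> T" "opp e \<in> T" for e
    using that one T(2) by blast
  have k_neq: "k (fst e) \<noteq> k (fst (opp e))" if "e \<in> tree_arcs" for e
    using that by (cases rule: tree_arcs_cases) auto
  have below: "e = \<pi> (fst e)" if e: "e \<in> T" "l (snd e) < k (fst e)" for e
  proof -
    obtain d where d: "d \<in> T" "snd d = snd e" "k (fst d) = l (snd e)"
      using l_attained[OF e(1)] by blast
    then have "opp e = d" using e T(2) by (intro opp_eqI) auto
    then have "e \<in> tree_arcs" "k (fst (opp e)) < k (fst e)" using both e d by auto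
    then show ?thesis by (cases rule: tree_arcs_cases) auto
  qed
  have lowest: "fst d = fst e"
    if "d \<in> T" "e \<in> T" "snd d = snd e" "k (fst d) \<le> l (snd d)" "k (fst e) \<le> l (snd e)" for d e
  proof (rule ccontr)
    assume "fst d \<noteq> fst e"
    then have "opp d = e" using that T(2) by (intro opp_eqI) auto
    moreover have "k (fst d) = k (fst e)" using that l_le[of d] l_le[of e] by simp
    ultimately show False using k_neq[of d] both[of d] that by auto
  qed
  let ?H = "\<lparr>pverts = pverts G, parcs = T\<rparr>"
  have "Digraph_Component.connected (with_proj ?H)"
  proof (rule connected_by_lower_neighbours[where r = r and k = K])
    show "parcs ?H \<subseteq> pverts ?H \<times> pverts ?H"
      using T(2) by (auto simp: verts intro: rev_image_eqI)
    show "r \<in> pverts ?H" using root verts by simp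
    fix v assume v: "v \<in> pverts ?H" "v \<noteq> r"
    show "\<exists>u. ((u, v) \<in> parcs ?H \<or> (v, u) \<in> parcs ?H) \<and> K u < K v"
    proof (cases "v \<in> fst ` A")
      case True
      let ?e = "\<pi> v"
      have e: "?e \<in> tree_arcs" "?e \<in> A" "fst ?e = v" "k (fst (opp ?e)) < k v"
        using parent[OF True v(2)] parent_in_tree_arcs[OF True v(2)] by auto
      have "l (snd ?e) \<le> k (fst (opp ?e))"
        using l_le[of "opp ?e"] opp_tree_arcs[OF e(1)] T(1) e(2) by auto
      then have "K (snd ?e) < K v"
        using e K_snd[OF e(2)] K_fst[OF e(2)] by simp
      moreover have "(v, snd ?e) \<in> T" using e T(1) prod.collapse[of ?e] by auto
      ultimately show ?thesis by auto
    next
      case False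
      then obtain e where e: "e \<in> A" "snd e = v" using v verts by auto
      then obtain d where d: "d \<in> T" "snd d = v"
        using one[of e] T(1) opp_tree_arcs by (metis DiffI snd_opp subsetD)
      obtain c where c: "c \<in> T" "snd c = v" "k (fst c) = l v"
        using l_attained[OF d(1)] d by auto
      then have "K (fst c) < K v"
        using K_fst[of c] K_snd[of c] T(2) by auto
      moreover have "(fst c, v) \<in> T" using c by auto
      ultimately show ?thesis by auto
    qed
  qed
  moreover have "\<not> underlying_cycle ?H p" for p
  proof (rule no_cycle_by_unique_lower_neighbours[where k = K])
    fix v u w
    assume u: "(u, v) \<in> parcs ?H \<or> (v, u) \<in> parcs ?H" and w: "(w, v) \<in> parcs ?H \<or> (v, w) \<in> parcs ?H"
      and ku: "K u \<le> K v" and kw: "K w \<le> K v"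
    show "u = w"
    proof (cases "v \<in> fst ` A")
      case True
      have *: "x = snd (\<pi> v)" if x: "(x, v) \<in> T \<or> (v, x) \<in> T" "K x \<le> K v" for x
      proof -
        have vx: "(v, x) \<in> T" using x(1) True T(2) bipartite by force
        then have "l x < k v" using x(2) K_fst[of "(v, x)"] K_snd[of "(v, x)"] T(2) by auto
        then show ?thesis using below[OF vx] by (metis fst_conv snd_conv)
      qed
      show ?thesis using *[of u] *[of w] u w ku kw by simp
    next
      case False
      have *: "(x, v) \<in> T \<and> k x \<le> l v" if x: "(x, v) \<in> T \<or> (v, x) \<in> T" "K x \<le> K v" for x
      proof -
        have xv: "(x, v) \<in> T" using x(1) False T(2) by force
        then show ?thesis using x(2) K_fst[of "(x, v)"] K_snd[of "(x, v)"] T(2) by auto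
      qed
      show ?thesis using *[of u] *[of w] u w ku kw lowest[of "(u, v)" "(w, v)"] by simp
    qed
  qed
  ultimately show ?thesis using T(2) by (auto simp: spanning_tree_arcs_def)
qed

text \<open>
  The number of steps of the tour of \<open>H\<close> from the dart \<open>b\<close> to the dart
  \<open>e\<close>.
\<close>

abbreviation time :: "'a \<times> 'a \<Rightarrow> 'a \<times> 'a \<Rightarrow> nat" where
  "time b e \<equiv> funpow_dist dart_step b e"

text \<open>
  Outside the tree the dart that comes first in the tour from \<open>b\<close> is cut.
\<close>

definition attached_tree :: "'a \<times> 'a \<Rightarrow> ('a \<times> 'a) set" where
  "attached_tree b = tree_arcs \<union> {e \<in> A - tree_arcs. time b (opp e) < time b e}"

definition period :: "'a \<times> 'a \<Rightarrow> nat" where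
  "period b = funpow_dist1 dart_step b b"

lemma period_pos: "0 < period b"
  by (simp add: period_def)

lemma dart_step_period: "b \<in> A \<Longrightarrow> (dart_step ^^ period b) b = b"
  unfolding period_def using orbit_dart_step by (intro funpow_dist1_prop) auto

lemma dart_step_funpow_in: "b \<in> A \<Longrightarrow> (dart_step ^^ n) b \<in> A"
  by (induction n) (auto intro: dart_step_in)

lemma time_funpow:
  assumes "b \<in> A" "j < period b"
  shows "time b ((dart_step ^^ j) b) = j"
  unfolding funpow_dist_def
proof (rule Least_equality)
  fix i assume i: "(dart_step ^^ i) b = (dart_step ^^ j) b"
  show "j \<le> i"
  proof (rule ccontr)
    assume "\<not> j \<le> i"
    moreover have "inj_on (\<lambda>n. (dart_step ^^ n) b) {0..<period b}"
      unfolding period_def using orbit_dart_step assms by (intro inj_on_funpow_dist1) auto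
    ultimately show False using i assms(2) by (auto dest!: inj_onD)
  qed
qed simp

lemma funpow_time:
  assumes "b \<in> A" "e \<in> A"
  shows "time b e < period b" "(dart_step ^^ time b e) b = e"
proof -
  have "e \<in> (\<lambda>n. (dart_step ^^ n) b) ` {0..<period b}"
    unfolding period_def using orbit_conv_funpow_dist1[of b dart_step] orbit_dart_step[OF assms(1)] assms by auto
  then obtain j where "j < period b" "e = (dart_step ^^ j) b" by auto
  then show "time b e < period b" "(dart_step ^^ time b e) b = e"
    using time_funpow[OF assms(1)] by auto
qed

lemma time_inj: "b \<in> A \<Longrightarrow> d \<in> A \<Longrightarrow> e \<in> A \<Longrightarrow> time b d = time b e \<Longrightarrow> d = e"
  using funpow_time(2) by metis

text \<open>
  A tour that starts outside \<open>U\<close> has to leave \<open>U\<close> after each visit, and can only do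
  so at \<open>z\<close>. This gives the order of two darts without computing the whole tour.
\<close>

lemma time_less_exit:
  assumes b: "b \<in> A" "b \<notin> U" and U: "U \<subseteq> A" and exit: "\<And>e. e \<in> U \<Longrightarrow> dart_step e \<in> U \<or> dart_step e = z"
    and z: "z \<noteq> b" and e: "e \<in> U"
  shows "time b e < time b z"
proof -
  define j where "j = time b e"
  have eA: "e \<in> A" using U e by blast
  have j: "j < period b" "(dart_step ^^ j) b = e" using funpow_time[OF b(1) eA] by (auto simp: j_def)
  let ?out = "\<lambda>i. (dart_step ^^ (j + i)) b \<notin> U"
  have out: "?out (period b - j)" using j(1) dart_step_period[OF b(1)] b(2) by simp
  define i where "i = (LEAST i. ?out i)"
  have i: "?out i" "i \<le> period b - j" unfolding i_def using out by (rule LeastI, rule Least_le)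
  then obtain i' where i': "i = Suc i'" using j(2) e by (cases i) auto
  have "(dart_step ^^ (j + i')) b \<in> U" using not_less_Least[of i' ?out] i' i_def by simp
  then have hz: "(dart_step ^^ (j + i)) b = z" using exit[of "(dart_step ^^ (j + i')) b"] i(1) i' by auto
  have "j + i \<noteq> period b" using hz z dart_step_period[OF b(1)] by metis
  then have "j + i < period b" using i(2) j(1) by linarith
  then have "time b z = j + i" using time_funpow[OF b(1)] hz by blast
  then show ?thesis using i' j_def by simp
qed

lemma tree_arcs_subset_attached: "tree_arcs \<subseteq> attached_tree b" and attached_tree_subset: "attached_tree b \<subseteq> A"
  using tree_arcs_subset by (auto simp: attached_tree_def)

lemma attached_tree_iff:
  assumes "b \<in> A" "e \<in> A - tree_arcs"
  shows "e \<in> attached_tree b \<longleftrightarrow> opp e \<notin> attached_tree b"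
proof -
  have "time b (opp e) \<noteq> time b e"
    using time_inj[of b "opp e" e] opp_in[of e] opp_neq[of e] assms by auto
  moreover have "opp e \<in> A - tree_arcs" using assms opp_in opp_tree_arcs_iff by blast
  ultimately show ?thesis using assms by (auto simp: attached_tree_def)
qed

lemma attachment_attached_tree: "b \<in> A \<Longrightarrow> attachment (attached_tree b)"
  unfolding attachment_def using tree_arcs_subset_attached attached_tree_subset attached_tree_iff by blast

text \<open>
  The part of the tour in the subdivision that corresponds to the dart \<open>e\<close>. If \<open>e\<close> is cut,
  the tour just turns. If both halves are present, it passes through the midpoint. If only
  \<open>e\<close> is present, the midpoint is a leaf, the tour looks at the cut half from there and returns.
\<close>

definition expand :: "('a \<times> 'a) set \<Rightarrow> 'a \<times> 'a \<Rightarrow> ('a \<times> 'a \<times> 'a) list" where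
  "expand S e = (fst e, e) #
     (if e \<in> S then (snd e, opp e) # (if opp e \<in> S then [] else [(snd e, e)]) else [])"

lemma tour_step_simps:
  assumes "e \<in> A"
  shows "e \<notin> S \<Longrightarrow> tour_step \<sigma> S (fst e, e) = (fst e, turn e)"
    and "e \<in> S \<Longrightarrow> tour_step \<sigma> S (fst e, e) = (snd e, opp e)"
    and "e \<notin> S \<Longrightarrow> tour_step \<sigma> S (snd e, e) = (snd e, opp e)"
    and "e \<in> S \<Longrightarrow> tour_step \<sigma> S (snd e, e) = (fst e, turn e)"
  using fst_neq_snd[OF assms assms] by (simp_all add: tour_step_def other_end_def turn_def opp_def)

lemma expand_step:
  assumes "e \<in> A" and S: "attachment S"
  shows "orbit_list (tour_step \<sigma> S) (fst e, e) (length (expand S e)) = expand S e"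
    and "(tour_step \<sigma> S ^^ length (expand S e)) (fst e, e) = (fst (dart_step e), dart_step e)"
proof -
  let ?f = "tour_step \<sigma> S"
  note step = tour_step_simps[OF assms(1), of S] tour_step_simps[OF opp_in[OF assms(1)], of S]
  consider "e \<notin> S" | "e \<in> tree_arcs" | "e \<in> S" "e \<notin> tree_arcs" by blast
  then have "orbit_list ?f (fst e, e) (length (expand S e)) = expand S e \<and>
    (?f ^^ length (expand S e)) (fst e, e) = (fst (dart_step e), dart_step e)"
  proof cases
    case 1
    then have "e \<notin> tree_arcs" using S by (auto simp: attachment_def)
    then show ?thesis using 1 step assms(1) by (simp add: expand_def orbit_list_def dart_step_def cross_def)
  next
    case 2
    then have "e \<in> S" "opp e \<in> S" using S opp_tree_arcs[OF 2] by (auto simp: attachment_def)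
    then show ?thesis
      using 2 step assms(1) by (simp add: expand_def orbit_list_def dart_step_def cross_def upt_rec opp_in)
  next
    case 3
    then have "opp e \<notin> S" using assms by (auto simp: attachment_def)
    then show ?thesis
      using 3 step assms(1) by (simp add: expand_def orbit_list_def dart_step_def cross_def upt_rec opp_in)
  qed
  then show "orbit_list ?f (fst e, e) (length (expand S e)) = expand S e"
    "(?f ^^ length (expand S e)) (fst e, e) = (fst (dart_step e), dart_step e)" by auto
qed

lemma expand_tour:
  assumes "b \<in> A" and S: "attachment S"
  shows "\<exists>n\<ge>m. orbit_list (tour_step \<sigma> S) (fst b, b) n = concat (map (expand S) (orbit_list dart_step b m)) \<and>
    (tour_step \<sigma> S ^^ n) (fst b, b) = (fst ((dart_step ^^ m) b), (dart_step ^^ m) b)"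
proof (induction m)
  case 0
  show ?case by (rule exI[of _ 0]) (simp add: orbit_list_0)
next
  case (Suc m)
  let ?f = "tour_step \<sigma> S" and ?e = "(dart_step ^^ m) b"
  obtain n where n: "n \<ge> m" "orbit_list ?f (fst b, b) n = concat (map (expand S) (orbit_list dart_step b m))"
    "(?f ^^ n) (fst b, b) = (fst ?e, ?e)" using Suc by blast
  note step = expand_step[OF dart_step_funpow_in[OF assms(1), of m] S]
  have "length (expand S ?e) \<ge> 1" by (simp add: expand_def)
  moreover have "orbit_list ?f (fst b, b) (n + length (expand S ?e)) =
      concat (map (expand S) (orbit_list dart_step b (Suc m)))"
    by (simp add: orbit_list_add n step orbit_list_Suc)
  moreover have "(?f ^^ (n + length (expand S ?e))) (fst b, b) = (fst ((dart_step ^^ Suc m) b), (dart_step ^^ Suc m) b)"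
    by (subst add.commute) (simp add: funpow_add n step)
  ultimately show ?case using n(1) by (intro exI[of _ "n + length (expand S ?e)"]) auto
qed

lemma distinct_expand:
  assumes "set W \<subseteq> A" "distinct W"
  shows "distinct (concat (map (expand S) W))"
  using assms
proof (induction W)
  case (Cons e W)
  have disjoint: "set (expand S e) \<inter> set (expand S d) = {}" if "d \<in> set W" for d
  proof -
    have de: "d \<in> A" "e \<in> A" "d \<noteq> e" using that Cons.prems by auto
    then have "opp d \<noteq> opp e" using opp_opp[of d] opp_opp[of e] by metis
    moreover have "fst d \<noteq> snd e" "fst e \<noteq> snd d" using de fst_neq_snd by auto
    moreover have "e \<noteq> opp d" if "d \<noteq> opp e" using that opp_opp[OF de(1)] by metis
    moreover have "e = opp d" if "d = opp e" using that opp_opp[OF de(2)] by metis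
    ultimately show ?thesis
      using de(3) by (cases "d = opp e") (auto simp: expand_def split: if_splits)
  qed
  moreover have "distinct (expand S e)"
    using fst_neq_snd[of e e] opp_neq[of e] Cons.prems by (simp add: expand_def)
  ultimately show ?case using Cons.IH Cons.prems by auto
qed simp


text \<open>
  A cut dart \<open>e\<close> precedes \<open>opp e\<close> in the tour of \<open>H\<close>. The
  pair of \<open>e\<close> with its tail is seen at the time of \<open>e\<close>, and the pair with its
  head during the detour from \<open>opp e\<close>, hence later; this is the Jaeger condition. For a base
  \<open>(snd e, e)\<close> at a midpoint the tour goes on to the dart
  \<open>turn e\<close>, and the base itself is the last pair of the tour from there. Moving it to the
  front does no harm, because it concerns an arc of the tree.
\<close>

lemma jaeger_attached_tree:
  assumes b: "b \<in> A"
  shows "jaeger_tree G \<sigma> (fst b, b) (attached_tree b)"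
    and "e \<in> A \<Longrightarrow> turn e = b \<Longrightarrow> jaeger_tree G \<sigma> (snd e, e) (attached_tree b)"
proof -
  let ?f = "tour_step \<sigma> (attached_tree b)"
  define W where "W = orbit_list dart_step b (period b)"
  obtain n where n: "n \<ge> period b" "orbit_list ?f (fst b, b) n = concat (map (expand (attached_tree b)) W)"
      "(?f ^^ n) (fst b, b) = (fst b, b)"
    using expand_tour[OF b attachment_attached_tree[OF b], of "period b"] dart_step_period[OF b] by (auto simp: W_def)
  define L where "L = concat (map (expand (attached_tree b)) W)"
  have set_W: "set W \<subseteq> A"
    using dart_step_funpow_in[OF b] by (auto simp: W_def orbit_list_def)
  have W_time: "W ! time b e = e" "time b e < length W" if "e \<in> A" for e
    using funpow_time[OF b that] by (simp_all add: W_def)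
  have "distinct W"
    unfolding W_def distinct_conv_nth using time_funpow[OF b] by (metis length_orbit_list nth_orbit_list)
  then have L: "distinct (orbit_list ?f (fst b, b) n)" "orbit_list ?f (fst b, b) n = L"
    using distinct_expand[OF set_W] n(2) by (simp_all add: L_def)
  have "0 < n" using n(1) period_pos[of b] by simp
  have precedes: "\<exists>xs ys zs. L = xs @ (fst e, e) # ys @ (snd e, e) # zs" if e: "e \<in> A - attached_tree b" for e
  proof -
    have oe: "opp e \<in> A" "opp e \<in> attached_tree b" "e \<notin> tree_arcs"
      using e attached_tree_iff[OF b, of e] tree_arcs_subset_attached[of b] opp_in[of e] by auto
    have less: "time b e < time b (opp e)"
      using e oe time_inj[OF b, of e "opp e"] opp_neq[of e] opp_tree_arcs_iff[of e] by (auto simp: attached_tree_def)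
    define us vs ws where "us = take (time b e) W"
      and "vs = take (time b (opp e) - Suc (time b e)) (drop (Suc (time b e)) W)"
      and "ws = drop (Suc (time b (opp e))) W"
    have "W = us @ e # drop (Suc (time b e)) W"
      using W_time[of e] e id_take_nth_drop[of "time b e" W] by (simp add: us_def)
    moreover have "drop (Suc (time b e)) W = vs @ opp e # ws"
      using W_time[OF oe(1)] less
        id_take_nth_drop[of "time b (opp e) - Suc (time b e)" "drop (Suc (time b e)) W"]
      by (simp add: vs_def ws_def)
    ultimately have "W = us @ e # vs @ opp e # ws" by simp
    moreover have "expand (attached_tree b) e = [(fst e, e)]" using e by (simp add: expand_def)
    moreover have "expand (attached_tree b) (opp e) =
        [(fst (opp e), opp e), (snd e, e), (snd e, opp e)]"
      using e oe by (simp add: expand_def)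
    ultimately have "L = concat (map (expand (attached_tree b)) us) @ (fst e, e) #
        (concat (map (expand (attached_tree b)) vs) @ [(fst (opp e), opp e)]) @ (snd e, e) #
        (snd e, opp e) # concat (map (expand (attached_tree b)) ws)"
      by (simp add: L_def)
    then show ?thesis by blast
  qed
  note tree = spanning_tree_attachment[OF attachment_attached_tree[OF b]]
  have "tour \<sigma> (fst b, b) (attached_tree b) = L"
    using tour_eq_orbit_list[OF \<open>0 < n\<close> n(3) L(1)] L(2) by simp
  then show "jaeger_tree G \<sigma> (fst b, b) (attached_tree b)"
    unfolding jaeger_tree_def using tree precedes precedes_inI
    by (metis (no_types, lifting) case_prodI2 fst_conv snd_conv)
  show "jaeger_tree G \<sigma> (snd e, e) (attached_tree b)" if e: "e \<in> A" "turn e = b"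
  proof -
    obtain m where m: "period b = Suc m" using period_pos[of b] by (cases "period b") auto
    \<comment> \<open>The last dart of the tour from \<open>b\<close>. It is \<open>e\<close> or \<open>opp e\<close>,
      and in both cases its part of the tour ends at the midpoint.\<close>
    define d where "d = (dart_step ^^ m) b"
    have d: "d \<in> A" "dart_step d = b" "W = orbit_list dart_step b m @ [d]"
      using dart_step_funpow_in[OF b] dart_step_period[OF b] m by (simp_all add: d_def W_def orbit_list_Suc)
    have "time b d = m" using time_funpow[OF b, of m] m d_def by simp
    have "cross d = e" using d e turn_inj[OF cross_in] by (simp add: dart_step_def)
    have "last (expand (attached_tree b) d) = (snd e, e) \<and> e \<in> attached_tree b"
    proof (cases "d \<in> tree_arcs")
      case True
      then have "e = opp d" "opp d \<in> tree_arcs" using \<open>cross d = e\<close> opp_tree_arcs[OF True] by (auto simp: cross_def)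
      then show ?thesis using tree_arcs_subset_attached[of b] True d(1) by (auto simp: expand_def)
    next
      case False
      then have "e = d" using \<open>cross d = e\<close> by (simp add: cross_def)
      have "time b (opp e) \<noteq> m"
        using time_inj[OF b, of "opp e" e] opp_in opp_neq e \<open>e = d\<close> \<open>time b d = m\<close> by auto
      moreover have "time b (opp e) < Suc m"
        using funpow_time(1)[OF b, of "opp e"] opp_in e m by simp
      ultimately have "e \<in> attached_tree b" "opp e \<notin> attached_tree b"
        using False \<open>e = d\<close> \<open>time b d = m\<close> e attached_tree_iff[OF b, of e] by (auto simp: attached_tree_def)
      then show ?thesis using \<open>e = d\<close> by (simp add: expand_def)
    qed
    moreover have "expand (attached_tree b) d \<noteq> []" by (simp add: expand_def)
    ultimately have last: "last L = (snd e, e)" and "e \<in> attached_tree b"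
      by (simp_all add: L_def d(3))
    have "tour \<sigma> (snd e, e) (attached_tree b) = (snd e, e) # butlast L"
      using tour_shift_back[OF \<open>0 < n\<close> n(3) L(1)] L(2) last by simp
    moreover have "precedes_in ((snd e, e) # butlast L) (fst c, c) (snd c, c)" if c: "c \<in> A - attached_tree b" for c
    proof -
      obtain xs ys zs where xyz: "L = xs @ (fst c, c) # ys @ (snd c, c) # zs"
        using precedes[OF c] by blast
      have "zs \<noteq> []"
      proof
        assume "zs = []"
        then have "(snd c, c) = (snd e, e)" using last xyz by simp
        then show False using c \<open>e \<in> attached_tree b\<close> by simp
      qed
      then have "(snd e, e) # butlast L = ((snd e, e) # xs) @ (fst c, c) # ys @ (snd c, c) # butlast zs"
        using xyz by (simp add: butlast_append)
      then show ?thesis using precedes_inI by metis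
    qed
    ultimately show ?thesis
      unfolding jaeger_tree_def using tree by auto
  qed
qed

text \<open>
  Also from a base at a midpoint the tour first goes to the tail of the base arc, so in all cases
  \<open>fst (snd b)\<close> is the vertex of \<open>H\<close> where the tour starts.
\<close>

lemma jaeger_tree_for_basis:
  assumes "is_basis G b"
  shows "\<exists>d\<in>A. fst d = fst (snd b) \<and> jaeger_tree G \<sigma> b (attached_tree d)"
proof -
  obtain x e where b: "b = (x, e)" by (cases b)
  then have e: "e \<in> A" "x = fst e \<or> x = snd e"
    using assms by (auto simp: is_basis_def incident_arcs_def)
  from e(2) show ?thesis
  proof
    assume "x = fst e"
    then show ?thesis using jaeger_attached_tree(1)[OF e(1)] e(1) b by auto
  next
    assume "x = snd e"
    then show ?thesis
      using jaeger_attached_tree(2)[OF turn_in[OF e(1)] e(1) refl] fst_turn[OF e(1)] b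
      by (intro bexI[OF _ turn_in[OF e(1)]]) simp
  qed
qed

end

section \<open>Subdivided complete bipartite graphs\<close>

definition subdivided_biclique :: "('a \<Rightarrow> 'a \<Rightarrow> 'a) \<Rightarrow> 'a set \<Rightarrow> 'a set \<Rightarrow> 'a pair_pre_digraph" where
  "subdivided_biclique mid P Q =
     \<lparr>pverts = P \<union> Q \<union> (\<Union>p\<in>P. \<Union>q\<in>Q. {mid p q}),
      parcs = (\<Union>p\<in>P. \<Union>q\<in>Q. {(p, mid p q), (q, mid p q)})\<rparr>"

locale biclique =
  fixes mid :: "'a \<Rightarrow> 'a \<Rightarrow> 'a" and P Q :: "'a set" and G
  assumes G_eq: "G = subdivided_biclique mid P Q"
    and finite: "finite P" "finite Q" and nonempty: "P \<noteq> {}" "Q \<noteq> {}" and disjoint: "P \<inter> Q = {}"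
    and mid_new: "p \<in> P \<Longrightarrow> q \<in> Q \<Longrightarrow> mid p q \<notin> P \<union> Q"
    and mid_inj: "p \<in> P \<Longrightarrow> q \<in> Q \<Longrightarrow> p' \<in> P \<Longrightarrow> q' \<in> Q \<Longrightarrow> mid p q = mid p' q' \<Longrightarrow> p = p' \<and> q = q'"
begin

lemma arcsE:
  assumes "e \<in> parcs G"
  obtains p q where "p \<in> P" "q \<in> Q" "e = (p, mid p q) \<or> e = (q, mid p q)"
  using assms by (auto simp: G_eq subdivided_biclique_def)

lemma arcsI: "p \<in> P \<Longrightarrow> q \<in> Q \<Longrightarrow> (p, mid p q) \<in> parcs G"
    "p \<in> P \<Longrightarrow> q \<in> Q \<Longrightarrow> (q, mid p q) \<in> parcs G"
  by (auto simp: G_eq subdivided_biclique_def)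

lemma tails: "fst ` parcs G = P \<union> Q"
proof
  show "fst ` parcs G \<subseteq> P \<union> Q" by (auto elim!: arcsE)
  obtain p q where "p \<in> P" "q \<in> Q" using nonempty by auto
  then show "P \<union> Q \<subseteq> fst ` parcs G"
    using arcsI by (force simp: image_iff)
qed

lemma heads: "snd ` parcs G = (\<Union>p\<in>P. \<Union>q\<in>Q. {mid p q})"
proof
  show "snd ` parcs G \<subseteq> (\<Union>p\<in>P. \<Union>q\<in>Q. {mid p q})"
  proof
    fix m assume "m \<in> snd ` parcs G"
    then obtain e where e: "e \<in> parcs G" "m = snd e" by blast
    from e(1) obtain p q where "p \<in> P" "q \<in> Q" "snd e = mid p q" by (auto elim: arcsE)
    with e(2) show "m \<in> (\<Union>p\<in>P. \<Union>q\<in>Q. {mid p q})" by blast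
  qed
  show "(\<Union>p\<in>P. \<Union>q\<in>Q. {mid p q}) \<subseteq> snd ` parcs G"
  proof
    fix m assume "m \<in> (\<Union>p\<in>P. \<Union>q\<in>Q. {mid p q})"
    then obtain p q where "p \<in> P" "q \<in> Q" "m = mid p q" by blast
    then show "m \<in> snd ` parcs G" using imageI[OF arcsI(1), of p q snd] by simp
  qed
qed

lemma verts_eq: "pverts G = fst ` parcs G \<union> snd ` parcs G"
  unfolding tails heads by (simp add: G_eq subdivided_biclique_def)

lemma halves_at:
  assumes "p \<in> P" "q \<in> Q"
  shows "{d \<in> parcs G. snd d = mid p q} = {(p, mid p q), (q, mid p q)}"
proof
  show "{d \<in> parcs G. snd d = mid p q} \<subseteq> {(p, mid p q), (q, mid p q)}"
  proof
    fix d assume d: "d \<in> {d \<in> parcs G. snd d = mid p q}"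
    then obtain p' q' where p'q': "p' \<in> P" "q' \<in> Q" "d = (p', mid p' q') \<or> d = (q', mid p' q')"
      by (auto elim: arcsE)
    then have "mid p q = mid p' q'" using d by auto
    then have "p = p' \<and> q = q'" using mid_inj[OF assms p'q'(1,2)] by blast
    then show "d \<in> {(p, mid p q), (q, mid p q)}" using p'q'(3) by simp
  qed
qed (use assms arcsI in auto)

lemma ribbon_subdivision:
  assumes "ribbon_structure G \<sigma>"
  shows "ribbon_subdivision G \<sigma>"
proof
  show "finite (parcs G)" using finite by (simp add: G_eq subdivided_biclique_def)
  show "pverts G = fst ` parcs G \<union> snd ` parcs G" by (rule verts_eq)
  show "fst ` parcs G \<inter> snd ` parcs G = {}"
    unfolding tails heads using mid_new by auto
  show "ribbon_structure G \<sigma>" by fact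
  fix e assume "e \<in> parcs G"
  then obtain p q where pq: "p \<in> P" "q \<in> Q" "snd e = mid p q" by (auto elim: arcsE)
  then have "p \<noteq> q" using disjoint by auto
  then show "card {d \<in> parcs G. snd d = snd e} = 2"
    unfolding pq(3) halves_at[OF pq(1,2)] by simp
qed

lemma oriented: "oriented_graph G"
  unfolding oriented_graph_def
proof
  show "pair_digraph G"
  proof
    show "finite (parcs G)" "finite (pverts G)"
      using finite by (simp_all add: G_eq subdivided_biclique_def)
    fix e assume "e \<in> parcs G"
    then show "fst e \<in> pverts G" "snd e \<in> pverts G" unfolding verts_eq by simp_all
    from \<open>e \<in> parcs G\<close> obtain p q where "p \<in> P" "q \<in> Q" "e = (p, mid p q) \<or> e = (q, mid p q)"
      by (rule arcsE)
    then show "fst e \<noteq> snd e" using mid_new[of p q] by auto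
  qed
  show "asym (parcs G)"
  proof (rule asymI)
    fix t h assume "(t, h) \<in> parcs G"
    then have "h \<in> snd ` parcs G" by force
    then have "h \<notin> fst ` parcs G" unfolding tails heads using mid_new by auto
    then show "(h, t) \<notin> parcs G" by force
  qed
qed

lemma connected: "Digraph_Component.connected (with_proj G)"
proof -
  obtain p0 q0 where p0: "p0 \<in> P" and q0: "q0 \<in> Q" using nonempty by auto
  \<comment> \<open>The distance from \<open>p0\<close>.\<close>
  define k :: "'a \<Rightarrow> nat" where
    "k v = (if v = p0 then 0 else if v \<in> Q then 2 else if v \<in> P then 4
      else if \<exists>q\<in>Q. v = mid p0 q then 1 else 3)" for v
  have "p0 \<notin> Q" using p0 disjoint by blast
  show ?thesis
  proof (rule connected_by_lower_neighbours[where r = p0 and k = k])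
    show "parcs G \<subseteq> pverts G \<times> pverts G" by (auto simp: G_eq subdivided_biclique_def)
    show "p0 \<in> pverts G" using p0 by (simp add: G_eq subdivided_biclique_def)
    fix v assume v: "v \<in> pverts G" "v \<noteq> p0"
    then consider "v \<in> P" | "v \<in> Q" | p q where "p \<in> P" "q \<in> Q" "v = mid p q"
      by (auto simp: G_eq subdivided_biclique_def)
    then show "\<exists>u. ((u, v) \<in> parcs G \<or> (v, u) \<in> parcs G) \<and> k u < k v"
    proof cases
      case 1
      then have "k v = 4" using v disjoint by (auto simp: k_def)
      moreover have "k (mid v q0) \<le> 3" using mid_new[OF 1 q0] by (simp add: k_def)
      ultimately show ?thesis using arcsI(1)[OF 1 q0] by (intro exI[of _ "mid v q0"]) simp
    next
      case 2
      then have "k v = 2" using v by (simp add: k_def)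
      moreover have "k (mid p0 v) \<le> 1" using mid_new[OF p0 2] 2 by (auto simp: k_def)
      ultimately show ?thesis using arcsI(2)[OF p0 2] by (intro exI[of _ "mid p0 v"]) simp
    next
      case 3
      note new = mid_new[OF 3(1,2)]
      show ?thesis
      proof (cases "p = p0")
        case True
        then have "k p < k v" using new 3 v by (auto simp: k_def)
        then show ?thesis using arcsI(1)[OF 3(1,2)] 3(3) by blast
      next
        case False
        then have "k v = 3" using new 3 v mid_inj[OF 3(1,2) p0] by (auto simp: k_def)
        moreover have "k q = 2" using 3 \<open>p0 \<notin> Q\<close> by (auto simp: k_def)
        ultimately show ?thesis using arcsI(2)[OF 3(1,2)] 3(3) by (intro exI[of _ q]) simp
      qed
    qed
  qed
qed

lemma semi_balanced: "semi_balanced G"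
proof (rule semi_balanced_by_levels)
  fix t h assume "(t, h) \<in> parcs G"
  then show "(if h \<in> P \<union> Q then 0 else 1 :: int) = (if t \<in> P \<union> Q then 0 else 1) + 1"
    using mid_new by (auto elim!: arcsE)
qed

end

section \<open>Two crossing Jaeger trees of the subdivided complete bipartite graph on 3 + 3 vertices\<close>

locale labelled_K33 = biclique mid "{v, x1, x2}" "{y1, y2, y3}" G
  for mid :: "'a \<Rightarrow> 'a \<Rightarrow> 'a" and v x1 x2 y1 y2 y3 G +
  fixes \<sigma>
  assumes distinct: "distinct [v, x1, x2, y1, y2, y3]"
    and ribbon: "ribbon_structure G \<sigma>"
begin

lemma labels_neq:
  "v \<noteq> x1" "v \<noteq> x2" "v \<noteq> y1" "v \<noteq> y2" "v \<noteq> y3" "x1 \<noteq> x2" "x1 \<noteq> y1" "x1 \<noteq> y2" "x1 \<noteq> y3"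
  "x2 \<noteq> y1" "x2 \<noteq> y2" "x2 \<noteq> y3" "y1 \<noteq> y2" "y1 \<noteq> y3" "y2 \<noteq> y3"
  using distinct by auto

lemmas neqs = labels_neq labels_neq[symmetric]

lemma mid_eq_iff:
  assumes "p \<in> {v, x1, x2}" "q \<in> {y1, y2, y3}" "p' \<in> {v, x1, x2}" "q' \<in> {y1, y2, y3}"
  shows "mid p q = mid p' q' \<longleftrightarrow> p = p' \<and> q = q'"
  using mid_inj[OF assms] by blast

text \<open>
  The Hamiltonian path \<open>v, y1, x1, y2, x2, y3\<close> with root \<open>v\<close>.
\<close>

definition parent :: "'a \<Rightarrow> 'a \<times> 'a" where
  "parent = (\<lambda>_. (v, v))(y1 := (y1, mid v y1), x1 := (x1, mid x1 y1), y2 := (y2, mid x1 y2),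
     x2 := (x2, mid x2 y2), y3 := (y3, mid x2 y3))"

definition rank :: "'a \<Rightarrow> nat" where
  "rank = (\<lambda>_. 0)(y1 := 1, x1 := 2, y2 := 3, x2 := 4, y3 := 5)"

sublocale ribbon_subdivision G \<sigma>
  using ribbon by (rule ribbon_subdivision)

lemma opp_mid:
  assumes "p \<in> {v, x1, x2}" "q \<in> {y1, y2, y3}"
  shows "opp (p, mid p q) = (q, mid p q)" "opp (q, mid p q) = (p, mid p q)"
proof -
  have "p \<noteq> q" using assms disjoint by auto
  then show "opp (p, mid p q) = (q, mid p q)" "opp (q, mid p q) = (p, mid p q)"
    using arcsI[OF assms] by (auto intro: opp_eqI)
qed

sublocale subdivision_tree G \<sigma> v rank parent
proof
  show "v \<in> fst ` parcs G" using tails by simp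
  fix p assume "p \<in> fst ` parcs G" "p \<noteq> v"
  then consider "p = y1" | "p = x1" | "p = y2" | "p = x2" | "p = y3" unfolding tails by auto
  then show "parent p \<in> parcs G \<and> fst (parent p) = p \<and> rank (fst (opp (parent p))) < rank p"
    by cases (simp_all add: parent_def rank_def neqs opp_mid arcsI)
qed

lemma tree_arcs_eq: "tree_arcs = {(v, mid v y1), (y1, mid v y1), (x1, mid x1 y1), (y1, mid x1 y1), (x1, mid x1 y2),
    (y2, mid x1 y2), (x2, mid x2 y2), (y2, mid x2 y2), (x2, mid x2 y3), (y3, mid x2 y3)}"
proof -
  have "{v, x1, x2} \<union> {y1, y2, y3} - {v} = {y1, x1, y2, x2, y3}" using neqs by auto
  then show ?thesis
    unfolding tree_arcs_def tails by (auto simp: parent_def neqs opp_mid)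
qed

text \<open>
  The darts at \<open>x1\<close>, \<open>y2\<close>, \<open>x2\<close>, \<open>y3\<close> form the branch of
  the path beyond \<open>y1\<close>. The tour leaves it only across the edge from \<open>x1\<close> to
  \<open>y1\<close>, after which the cyclic order at \<open>y1\<close> shows the edge to
  \<open>x2\<close>. By then the whole branch has been visited, so this edge was met
  first at \<open>x2\<close>.
\<close>

lemma attached_tree_around_square:
  assumes d: "d \<in> A" "fst d = v" and rot: "\<sigma> y1 (y1, mid x1 y1) = (y1, mid x2 y1)"
  shows "(y1, mid x2 y1) \<in> attached_tree d" "(x2, mid x2 y1) \<notin> attached_tree d"
proof -
  define U where "U = {e \<in> A. fst e \<in> {x1, y2, x2, y3}}"
  let ?z = "(y1, mid x2 y1)"
  have "time d (x2, mid x2 y1) < time d ?z"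
  proof (rule time_less_exit)
    show "d \<in> A" "d \<notin> U" "U \<subseteq> A" "?z \<noteq> d" using d neqs by (auto simp: U_def)
    show "(x2, mid x2 y1) \<in> U" using arcsI by (simp add: U_def)
    fix e assume e: "e \<in> U"
    show "dart_step e \<in> U \<or> dart_step e = ?z"
    proof (cases "fst (cross e) \<in> {x1, y2, x2, y3}")
      case True
      then show ?thesis using e dart_step_in by (auto simp: U_def dart_step_def cross_in)
    next
      case False
      then have "e \<in> tree_arcs" using e by (auto simp: U_def cross_def split: if_splits)
      then have "e = (x1, mid x1 y1)"
        using False e unfolding tree_arcs_eq
        by (elim insertE emptyE) (simp_all add: U_def cross_def tree_arcs_eq opp_mid neqs)
      then have "dart_step e = \<sigma> y1 (y1, mid x1 y1)"
        using \<open>e \<in> tree_arcs\<close> arcsI by (simp add: dart_step_def cross_def opp_mid turn_def)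
      then show ?thesis using rot by simp
    qed
  qed
  moreover have "?z \<in> A - tree_arcs"
    using arcsI neqs by (auto simp: tree_arcs_eq mid_eq_iff)
  ultimately show "(y1, mid x2 y1) \<in> attached_tree d" "(x2, mid x2 y1) \<notin> attached_tree d"
    using attached_tree_iff[OF d(1), of ?z] by (auto simp: attached_tree_def opp_mid)
qed

lemma jaeger_tree_around_square:
  assumes b: "is_basis G b" "fst (snd b) = v" and rot: "\<sigma> y1 (y1, mid x1 y1) = (y1, mid x2 y1)"
  shows "\<exists>S. jaeger_tree G \<sigma> b S \<and> (x2, mid x2 y1) \<notin> S \<and>
    {(x1, mid x1 y1), (y1, mid x1 y1), (x1, mid x1 y2), (y2, mid x1 y2),
     (x2, mid x2 y2), (y2, mid x2 y2), (y1, mid x2 y1)} \<subseteq> S"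
proof -
  obtain d where d: "d \<in> A" "fst d = v" "jaeger_tree G \<sigma> b (attached_tree d)"
    using jaeger_tree_for_basis[OF b(1)] b(2) by auto
  then show ?thesis
    using attached_tree_around_square[OF d(1,2) rot] tree_arcs_subset_attached[of d]
    by (intro exI[of _ "attached_tree d"]) (simp add: tree_arcs_eq)
qed

text \<open>
  Otherwise both edges are followed by the one to \<open>v\<close>, contrary to injectivity.
\<close>

lemma rotation_dichotomy:
  assumes "y \<in> {y1, y2, y3}"
  shows "\<sigma> y (y, mid x1 y) = (y, mid x2 y) \<or> \<sigma> y (y, mid x2 y) = (y, mid x1 y)"
proof -
  let ?e = "\<lambda>p. (y, mid p y)"
  have e: "?e p \<in> A" if "p \<in> {v, x1, x2}" for p using arcsI that assms by blast
  have star: "\<exists>p\<in>{v, x1, x2}. d = ?e p" if "d \<in> A" "fst d = y" for d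
  proof -
    from that(1) obtain p q
      where pq: "p \<in> {v, x1, x2}" "q \<in> {y1, y2, y3}" "d = (p, mid p q) \<or> d = (q, mid p q)"
      by (rule arcsE)
    moreover have "p \<noteq> y" using pq(1) assms disjoint by auto
    ultimately have "d = ?e p" using that(2) by auto
    with pq(1) show ?thesis by blast
  qed
  have turn: "\<exists>p'\<in>{v, x1, x2} - {p}. turn (?e p) = ?e p'" if p: "p \<in> {v, x1, x2}" for p
  proof -
    have "turn (?e p) \<noteq> ?e p"
    proof
      assume "turn (?e p) = ?e p"
      then have "orbit (\<sigma> y) (?e p) = {?e p}" by (simp add: turn_def orbit_eq_singleton_iff)
      moreover have "orbit (\<sigma> y) (?e p) = {d \<in> A. fst d = y}"
        using orbit_cyclic_eq3[OF rotation_fst(2)[OF e[OF p]]] e[OF p] by simp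
      ultimately have "?e p' = ?e p" if "p' \<in> {v, x1, x2}" for p'
        using e[OF that] by (metis (mono_tags, lifting) fst_conv mem_Collect_eq singletonD)
      from this[of x1] this[of x2] have "?e x1 = ?e x2" by simp
      then have "mid x1 y = mid x2 y" by simp
      then show False using mid_eq_iff[of x1 y x2 y] assms neqs by simp
    qed
    moreover obtain p' where "p' \<in> {v, x1, x2}" "turn (?e p) = ?e p'"
      using star[OF turn_in[OF e[OF p]]] fst_turn[OF e[OF p]] by auto
    ultimately show ?thesis by blast
  qed
  have "turn (?e x1) \<noteq> turn (?e x2)"
    using turn_inj[OF e e, of x1 x2] mid_eq_iff[of x1 y x2 y] assms neqs by auto
  then show ?thesis using turn[of x1] turn[of x2] by (auto simp: turn_def)
qed

end

text \<open>
  Around the square \<open>y1, x1, y2, x2\<close> the arc \<open>(x2, mid x2 y1)\<close>, missing in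
  \<open>S\<close>, points forward, and \<open>(x2, mid x2 y2)\<close>, missing in
  \<open>S'\<close>, points backward. The second tree is the first construction with \<open>y1\<close> and
  \<open>y2\<close> exchanged.
\<close>

lemma (in labelled_K33) two_trees_not_triangulation:
  assumes b: "is_basis G b" "fst (snd b) = v"
    and rot1: "\<sigma> y1 (y1, mid x1 y1) = (y1, mid x2 y1)"
    and rot2: "\<sigma> y2 (y2, mid x1 y2) = (y2, mid x2 y2)"
  shows "\<not> is_triangulation (jaeger_dissection G \<sigma> b)"
proof -
  have swap: "{y2, y1, y3} = {y1, y2, y3}" by auto
  interpret swapped: labelled_K33 mid v x1 x2 y2 y1 y3 G \<sigma>
    unfolding labelled_K33_def labelled_K33_axioms_def swap
    using biclique_axioms distinct ribbon by auto
  obtain S where S: "jaeger_tree G \<sigma> b S"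
    "{(x1, mid x1 y1), (y2, mid x1 y2), (x2, mid x2 y2), (y1, mid x2 y1)} \<subseteq> S"
    using jaeger_tree_around_square[OF b rot1] by auto
  obtain S' where S': "jaeger_tree G \<sigma> b S'" "(x2, mid x2 y2) \<notin> S'"
    "{(y1, mid x1 y1), (x1, mid x1 y2), (y2, mid x2 y2), (x2, mid x2 y1)} \<subseteq> S'"
    using swapped.jaeger_tree_around_square[OF b rot2] by auto
  have "\<not> (root_polytope S \<inter> root_polytope S') face_of root_polytope S"
  proof (rule crossing_circuit_not_common_face[OF _ S(2) _ S'(3)])
    show "(x2, mid x2 y2) \<notin> S'" by fact
    show "x2 \<noteq> mid x2 y2" using mid_new[of x2 y2] by auto
  qed (auto simp: mid_eq_iff neqs edge_vector_def algebra_simps)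
  then show ?thesis
    using S(1) S'(1) unfolding is_triangulation_def jaeger_dissection_def by blast
qed


lemma biclique_commute:
  assumes "biclique mid P Q G" and commute: "\<And>p q. mid p q = mid q p"
  shows "biclique mid Q P G"
proof -
  interpret biclique mid P Q G by fact
  have "subdivided_biclique mid Q P = subdivided_biclique mid P Q"
    unfolding subdivided_biclique_def using commute by auto
  moreover have "mid p q = mid p' q' \<Longrightarrow> p = p' \<and> q = q'"
    if "p \<in> Q" "q \<in> P" "p' \<in> Q" "q' \<in> P" for p q p' q'
    using mid_inj[OF that(2,1) that(4,3)] commute[of p q] commute[of p' q'] by simp
  moreover have "mid p q \<notin> Q \<union> P" if "p \<in> Q" "q \<in> P" for p q
    using mid_new[OF that(2,1)] commute[of p q] by simp
  ultimately show ?thesis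
    using G_eq finite nonempty disjoint unfolding biclique_def by (simp add: Int_commute)
qed

text \<open>
  The vertex \<open>v\<close> where the tour starts determines the roles of the two parts; the other
  roles are assigned by the pigeonhole principle on the cyclic orders at the vertices of the
  opposite part.
\<close>

lemma subdivided_K33_not_triangulation:
  assumes G: "biclique mid P Q G" and card: "card P = 3" "card Q = 3"
    and ribbon: "ribbon_structure G \<sigma>" and b: "is_basis G b" "fst (snd b) \<in> P"
  shows "\<not> is_triangulation (jaeger_dissection G \<sigma> b)"
proof -
  define v where "v = fst (snd b)"
  obtain x1 x2 where P: "P = {v, x1, x2}" "distinct [v, x1, x2]"
  proof -
    obtain p1 p2 p3 where p: "P = {p1, p2, p3}" "distinct [p1, p2, p3]"
      using card(1) by (auto simp: card_3_iff)
    have "v \<in> P" using b(2) by (simp add: v_def)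
    then consider "v = p1" | "v = p2" | "v = p3" using p(1) by auto
    then show ?thesis
    proof cases
      case 1 then show ?thesis using p that[of p2 p3] by auto
    next
      case 2 then show ?thesis using p that[of p1 p3] by auto
    next
      case 3 then show ?thesis using p that[of p1 p2] by auto
    qed
  qed
  obtain q1 q2 q3 where Q: "Q = {q1, q2, q3}" "distinct [q1, q2, q3]"
    using card(2) by (auto simp: card_3_iff)
  have "P \<inter> Q = {}" using G by (simp add: biclique_def)
  have labelled: "labelled_K33 mid v x x' y y' y'' G \<sigma>"
    if "{v, x, x'} = P" "{y, y', y''} = Q" "distinct [v, x, x']" "distinct [y, y', y'']" for x x' y y' y''
    unfolding labelled_K33_def labelled_K33_axioms_def that(1,2)
    using G ribbon that \<open>P \<inter> Q = {}\<close> by auto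
  define B where "B x x' y \<longleftrightarrow> \<sigma> y (y, mid x y) = (y, mid x' y)" for x x' y
  have not_triangulation: "\<not> is_triangulation (jaeger_dissection G \<sigma> b)"
    if "labelled_K33 mid v x x' y y' y'' G \<sigma>" "B x x' y" "B x x' y'" for x x' y y' y''
    using labelled_K33.two_trees_not_triangulation[OF that(1) b(1)] that(2,3) by (simp add: B_def v_def)
  have same: "\<not> is_triangulation (jaeger_dissection G \<sigma> b)"
    if y: "{y, y', y''} = Q" "distinct [y, y', y'']" and B: "B x1 x2 y \<longleftrightarrow> B x1 x2 y'" for y y' y''
  proof -
    have 1: "labelled_K33 mid v x1 x2 y y' y'' G \<sigma>" using labelled P y by auto
    have 2: "labelled_K33 mid v x2 x1 y y' y'' G \<sigma>"
      using labelled[of x2 x1 y y' y''] P y by (auto simp: insert_commute)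
    have "B x1 x2 y \<or> B x2 x1 y" "B x1 x2 y' \<or> B x2 x1 y'"
      using labelled_K33.rotation_dichotomy[OF 1, of y] labelled_K33.rotation_dichotomy[OF 1, of y']
      by (simp_all add: B_def)
    then show ?thesis using not_triangulation[OF 1] not_triangulation[OF 2] B by blast
  qed
  consider "B x1 x2 q1 = B x1 x2 q2" | "B x1 x2 q1 = B x1 x2 q3" | "B x1 x2 q2 = B x1 x2 q3" by blast
  then show ?thesis
  proof cases
    case 1 then show ?thesis using same[of q1 q2 q3] Q by auto
  next
    case 2 then show ?thesis using same[of q1 q3 q2] Q by auto
  next
    case 3 then show ?thesis using same[of q2 q3 q1] Q by auto
  qed
qed

theorem theorem10p4:
  shows "\<exists>G :: nat pair_pre_digraph.
    oriented_graph G \<and> Digraph_Component.connected (with_proj G) \<and> parcs G \<noteq> {} \<and>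
    semi_balanced G \<and>
    (\<forall>\<sigma> b. ribbon_structure G \<sigma> \<longrightarrow> is_basis G b \<longrightarrow>
       \<not> is_triangulation (jaeger_dissection G \<sigma> b))"
proof -
  \<comment> \<open>The nine sums \<open>p + q\<close> are different new vertices, and addition commutes, so that the
    two parts can be exchanged.\<close>
  define P Q :: "nat set" where "P = {1, 2, 3}" and "Q = {10, 20, 30}"
  define G where "G = subdivided_biclique (+) P Q"
  have PQ: "biclique (+) P Q G"
    by unfold_locales (auto simp: G_def P_def Q_def)
  then have QP: "biclique (+) Q P G"
    by (rule biclique_commute) (rule add.commute)
  interpret biclique "(+)" P Q G by (rule PQ)
  have card: "card P = 3" "card Q = 3" by (simp_all add: P_def Q_def)
  have "\<not> is_triangulation (jaeger_dissection G \<sigma> b)"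
    if \<sigma>: "ribbon_structure G \<sigma>" and b: "is_basis G b" for \<sigma> b
  proof -
    have "snd b \<in> parcs G" using b by (simp add: is_basis_def incident_arcs_def)
    then have "fst (snd b) \<in> P \<union> Q" using tails by blast
    then show ?thesis
      using subdivided_K33_not_triangulation[OF PQ card \<sigma> b]
        subdivided_K33_not_triangulation[OF QP card(2,1) \<sigma> b] by blast
  qed
  moreover have "parcs G \<noteq> {}" using arcsI(1)[of 1 10] by (auto simp: P_def Q_def)
  ultimately show ?thesis using oriented connected semi_balanced by blast
qed

end
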